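(* Let $\{X_n, n\ge 1\}$ be a stationary sequence of associated random variables with one-dimensional marginal distribution function $F$ and a bounded (one-dimensional marginal) density function. Assume $|X_n|<C_1<\infty$ for all $n\ge 1$, and $$\sum_{j=1}^{\infty}[\mathrm{Cov}(X_1,X_j)]^{\gamma}<\infty\quad\text{for some } 0<\gamma<1/6 .$$ Let $$U_n=\frac{2}{n(n-1)}\sum_{1\le i<j\le n}|X_i-X_j|,\qquad \theta=\int_{\mathbb R^2}|x-y|\,dF(x)\,dF(y),\qquad \rho_1(x)=\int_{\mathbb R}|x-y|\,dF(y),$$ and $$\sigma_U^2=\mathrm{Var}(\rho_1(X_1))+2\sum_{j=1}^{\infty}\mathrm{Cov}(\rho_1(X_1),\rho_1(X_{1+j})),$$ and assume $\sigma_U^2>0$. Then $$\frac{\sqrt n\,(U_n-\theta)}{2\sigma_U}\xrightarrow{\ \mathcal L\ }N(0,1)\quad\text{as } n\to\infty .$$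
   Context: Association: a finite collection $X_1,\dots,X_n$ of random variables is associated if $\mathrm{Cov}(h(X_1,\dots,X_n),g(X_1,\dots,X_n))\ge 0$ for all component-wise nondecreasing $h,g:\mathbb R^n\to\mathbb R$ for which the covariance exists; an infinite collection is associated if every finite sub-collection is. (In particular $\mathrm{Cov}(X_i,X_j)\ge 0$.) Stationary means strictly stationary. $U_n$ is Gini's mean difference. *)

theory Defs
  imports "HOL-Probability.Probability"
begin

definition covariance :: "'a measure \<Rightarrow> ('a \<Rightarrow> real) \<Rightarrow> ('a \<Rightarrow> real) \<Rightarrow> real" where
  "covariance M Y Z =
     (LINT \<omega>|M. (Y \<omega> - (LINT \<omega>'|M. Y \<omega>')) * (Z \<omega> - (LINT \<omega>'|M. Z \<omega>')))"

definition covariance_exists :: "'a measure \<Rightarrow> ('a \<Rightarrow> real) \<Rightarrow> ('a \<Rightarrow> real) \<Rightarrow> bool" where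
  "covariance_exists M Y Z \<longleftrightarrow>
     integrable M Y \<and> integrable M Z \<and> integrable M (\<lambda>\<omega>. Y \<omega> * Z \<omega>)"

(* For a finite index set I, the space of real vectors indexed by I is the extensional function
   space I \<rightarrow>\<^sub>E UNIV.  Its elements agree outside I, so the pointwise order used by mono_on is the
   componentwise order on the coordinates in I. *)
definition associated_finite :: "'a measure \<Rightarrow> 'i set \<Rightarrow> ('i \<Rightarrow> 'a \<Rightarrow> real) \<Rightarrow> bool" where
  "associated_finite M I X \<longleftrightarrow>
     (\<forall>h g :: ('i \<Rightarrow> real) \<Rightarrow> real.
        mono_on (I \<rightarrow>\<^sub>E UNIV) h \<longrightarrow> mono_on (I \<rightarrow>\<^sub>E UNIV) g \<longrightarrow>
        covariance_exists M (\<lambda>\<omega>. h (\<lambda>i\<in>I. X i \<omega>)) (\<lambda>\<omega>. g (\<lambda>i\<in>I. X i \<omega>)) \<longrightarrow>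
        covariance M (\<lambda>\<omega>. h (\<lambda>i\<in>I. X i \<omega>)) (\<lambda>\<omega>. g (\<lambda>i\<in>I. X i \<omega>)) \<ge> 0)"

definition associated :: "'a measure \<Rightarrow> 'i set \<Rightarrow> ('i \<Rightarrow> 'a \<Rightarrow> real) \<Rightarrow> bool" where
  "associated M J X \<longleftrightarrow> (\<forall>I. finite I \<longrightarrow> I \<subseteq> J \<longrightarrow> associated_finite M I X)"

(* Sequences are indexed by n \<ge> 1; the value X 0 plays no role. *)
definition strictly_stationary :: "'a measure \<Rightarrow> (nat \<Rightarrow> 'a \<Rightarrow> real) \<Rightarrow> bool" where
  "strictly_stationary M X \<longleftrightarrow>
     (\<forall>I k. finite I \<longrightarrow> I \<subseteq> {1..} \<longrightarrow>
        distr M (\<Pi>\<^sub>M i\<in>I. borel) (\<lambda>\<omega>. \<lambda>i\<in>I. X (i + k) \<omega>) =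
        distr M (\<Pi>\<^sub>M i\<in>I. borel) (\<lambda>\<omega>. \<lambda>i\<in>I. X i \<omega>))"

definition gini_mean_difference :: "(nat \<Rightarrow> 'a \<Rightarrow> real) \<Rightarrow> nat \<Rightarrow> 'a \<Rightarrow> real" where
  "gini_mean_difference X n \<omega> =
     2 / (real n * (real n - 1)) *
       (\<Sum>(i, j)\<in>{(i, j). 1 \<le> i \<and> i < j \<and> j \<le> n}. \<bar>X i \<omega> - X j \<omega>\<bar>)"

end

theory Submission
  imports Defs
begin

text \<open>
  With \<open>1\<^sub>t(x) = [x \<le> t]\<close> and all observations in \<open>[-C, C]\<close>, the kernel is
  \<open>|x - y| = \<integral> |1\<^sub>t(x) - 1\<^sub>t(y)| dt\<close>, so that its degenerate part
  \<open>|x - y| - \<rho>(x) - \<rho>(y) + \<theta>\<close> equals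
  \<open>-2 \<integral> (1\<^sub>t(x) - F(t)) (1\<^sub>t(y) - F(t)) dt\<close>. Its sum over all pairs is therefore
  \<open>-2 \<integral> (\<Sum>\<^sub>i (1\<^sub>t(X\<^sub>i) - F(t)))\<^sup>2 dt\<close>, a quantity of constant sign, and only its expectation has to
  be controlled. Smoothing the indicator on the scale \<open>Cov(X\<^sub>1, X\<^sub>j)\<^bsup>1/3\<^esup>\<close>, which is where the bounded
  density enters, bounds \<open>Cov(1\<^sub>t(X\<^sub>1), 1\<^sub>t(X\<^sub>j))\<close> by a multiple of \<open>Cov(X\<^sub>1, X\<^sub>j)\<^bsup>1/3\<^esup>\<close>, so this
  expectation is \<open>O(n)\<close> and the degenerate part is negligible.

  The linear part is a sum of the 1-Lipschitz function \<open>\<rho>\<close> of the observations. By association,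
  covariances of Lipschitz functions are dominated by covariances of the observations, hence the
  characteristic function of a sum over blocks of fixed length \<open>l\<close> differs from the product of the
  characteristic functions of the blocks by at most a multiple of the covariances between
  the blocks (Newman's inequality). This error vanishes as \<open>l \<rightarrow> \<infinity>\<close>.
\<close>

section \<open>Essentially bounded random variables and characteristic functions\<close>

context prob_space
begin

text \<open>This class is closed under sums, differences, products and trigonometric functions, so
  it settles the integrability side conditions of the covariance calculus. The bound is almost sure,
  as in the hypothesis on the observations.\<close>

definition ess_bounded :: "('a \<Rightarrow> real) \<Rightarrow> bool" where
  "ess_bounded Y \<longleftrightarrow> Y \<in> borel_measurable M \<and> (\<exists>B. AE \<omega> in M. \<bar>Y \<omega>\<bar> \<le> B)"

lemma ess_boundedI:
  "Y \<in> borel_measurable M \<Longrightarrow> AE \<omega> in M. \<bar>Y \<omega>\<bar> \<le> B \<Longrightarrow> ess_bounded Y"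
  unfolding ess_bounded_def by blast

lemma ess_bounded_measurable [measurable_dest]: "ess_bounded Y \<Longrightarrow> Y \<in> borel_measurable M"
  unfolding ess_bounded_def by blast

lemma ess_bounded_integrable: "ess_bounded Y \<Longrightarrow> integrable M Y"
  unfolding ess_bounded_def real_norm_def[symmetric] by (blast intro: integrable_const_bound)

lemma ess_bounded_const [simp]: "ess_bounded (\<lambda>_. c)"
  by (rule ess_boundedI[where B = "\<bar>c\<bar>"]) auto

lemma ess_bounded_add:
  assumes "ess_bounded Y" "ess_bounded Z"
  shows "ess_bounded (\<lambda>\<omega>. Y \<omega> + Z \<omega>)"
proof -
  from assms obtain B D where "AE \<omega> in M. \<bar>Y \<omega>\<bar> \<le> B" "AE \<omega> in M. \<bar>Z \<omega>\<bar> \<le> D"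
    unfolding ess_bounded_def by blast
  then have "AE \<omega> in M. \<bar>Y \<omega> + Z \<omega>\<bar> \<le> B + D" by eventually_elim auto
  with assms show ?thesis by (intro ess_boundedI) (auto dest: ess_bounded_measurable)
qed

lemma ess_bounded_mult:
  assumes "ess_bounded Y" "ess_bounded Z"
  shows "ess_bounded (\<lambda>\<omega>. Y \<omega> * Z \<omega>)"
proof -
  from assms obtain B D where "AE \<omega> in M. \<bar>Y \<omega>\<bar> \<le> B" "AE \<omega> in M. \<bar>Z \<omega>\<bar> \<le> D"
    unfolding ess_bounded_def by blast
  then have "AE \<omega> in M. \<bar>Y \<omega> * Z \<omega>\<bar> \<le> B * D"
    by eventually_elim (auto simp: abs_mult intro!: mult_mono)
  with assms show ?thesis by (intro ess_boundedI) (auto dest: ess_bounded_measurable)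
qed

lemma ess_bounded_minus: "ess_bounded Y \<Longrightarrow> ess_bounded (\<lambda>\<omega>. - Y \<omega>)"
  using ess_bounded_mult[of "\<lambda>_. -1" Y] by simp

lemma ess_bounded_diff:
  "ess_bounded Y \<Longrightarrow> ess_bounded Z \<Longrightarrow> ess_bounded (\<lambda>\<omega>. Y \<omega> - Z \<omega>)"
  using ess_bounded_add[of Y "\<lambda>\<omega>. - Z \<omega>"] ess_bounded_minus[of Z] by simp

lemma ess_bounded_sum:
  "(\<And>i. i \<in> I \<Longrightarrow> ess_bounded (Y i)) \<Longrightarrow> ess_bounded (\<lambda>\<omega>. \<Sum>i\<in>I. Y i \<omega>)"
  by (induction I rule: infinite_finite_induct) (auto intro: ess_bounded_add)

lemma ess_bounded_cos: "ess_bounded Y \<Longrightarrow> ess_bounded (\<lambda>\<omega>. cos (s * Y \<omega>))"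
  by (rule ess_boundedI[where B = 1]) (auto dest: ess_bounded_measurable)

lemma ess_bounded_sin: "ess_bounded Y \<Longrightarrow> ess_bounded (\<lambda>\<omega>. sin (s * Y \<omega>))"
  by (rule ess_boundedI[where B = 1]) (auto dest: ess_bounded_measurable)

lemmas ess_bounded_intros = ess_bounded_const ess_bounded_add ess_bounded_mult ess_bounded_minus
  ess_bounded_diff ess_bounded_sum ess_bounded_cos ess_bounded_sin

section \<open>Covariance calculus for essentially bounded variables\<close>

lemma covariance_eq:
  assumes "ess_bounded Y" "ess_bounded Z"
  shows "covariance M Y Z = expectation (\<lambda>\<omega>. Y \<omega> * Z \<omega>) - expectation Y * expectation Z"
proof -
  have "integrable M Y" "integrable M Z" "integrable M (\<lambda>\<omega>. Y \<omega> * Z \<omega>)"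
    using assms by (auto intro!: ess_bounded_integrable ess_bounded_intros)
  then show ?thesis unfolding covariance_def by (simp add: algebra_simps prob_space)
qed

lemma covariance_commute: "covariance M Y Z = covariance M Z Y"
  unfolding covariance_def by (simp add: mult.commute)

lemma covariance_add_left:
  assumes "ess_bounded Y" "ess_bounded Y'" "ess_bounded Z"
  shows "covariance M (\<lambda>\<omega>. Y \<omega> + Y' \<omega>) Z = covariance M Y Z + covariance M Y' Z"
proof -
  have "integrable M Y" "integrable M Y'"
    "integrable M (\<lambda>\<omega>. Y \<omega> * Z \<omega>)" "integrable M (\<lambda>\<omega>. Y' \<omega> * Z \<omega>)"
    using assms by (auto intro!: ess_bounded_integrable ess_bounded_intros)
  then show ?thesis
    using assms by (simp add: covariance_eq ess_bounded_intros algebra_simps)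
qed

lemma covariance_scale_left: "covariance M (\<lambda>\<omega>. a * Y \<omega>) Z = a * covariance M Y Z"
  unfolding covariance_def
  by (simp add: right_diff_distrib[symmetric] mult.assoc del: right_diff_distrib)

lemma covariance_scale_right: "covariance M Y (\<lambda>\<omega>. a * Z \<omega>) = a * covariance M Y Z"
  by (metis covariance_scale_left covariance_commute)

lemma covariance_const_left [simp]: "covariance M (\<lambda>_. a) Z = 0"
  unfolding covariance_def by (simp add: prob_space)

lemma covariance_const_right [simp]: "covariance M Z (\<lambda>_. a) = 0"
  unfolding covariance_def by (simp add: prob_space)

lemma covariance_minus_left: "covariance M (\<lambda>\<omega>. - Y \<omega>) Z = - covariance M Y Z"
  using covariance_scale_left[of "-1"] by simp

lemma covariance_diff_left:
  assumes "ess_bounded Y" "ess_bounded Y'" "ess_bounded Z"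
  shows "covariance M (\<lambda>\<omega>. Y \<omega> - Y' \<omega>) Z = covariance M Y Z - covariance M Y' Z"
  using covariance_add_left[of Y "\<lambda>\<omega>. - Y' \<omega>" Z] assms
  by (simp add: ess_bounded_intros covariance_minus_left)

lemma covariance_add_right:
  assumes "ess_bounded Y" "ess_bounded Z" "ess_bounded Z'"
  shows "covariance M Y (\<lambda>\<omega>. Z \<omega> + Z' \<omega>) = covariance M Y Z + covariance M Y Z'"
  using covariance_add_left[of Z Z' Y] assms by (simp add: covariance_commute)

lemma covariance_diff_right:
  assumes "ess_bounded Y" "ess_bounded Z" "ess_bounded Z'"
  shows "covariance M Y (\<lambda>\<omega>. Z \<omega> - Z' \<omega>) = covariance M Y Z - covariance M Y Z'"
  using covariance_diff_left[of Z Z' Y] assms by (simp add: covariance_commute)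

lemma covariance_sum_left:
  assumes "\<And>i. i \<in> I \<Longrightarrow> ess_bounded (Y i)" "ess_bounded Z"
  shows "covariance M (\<lambda>\<omega>. \<Sum>i\<in>I. Y i \<omega>) Z = (\<Sum>i\<in>I. covariance M (Y i) Z)"
  using assms
  by (induction I rule: infinite_finite_induct)
     (auto simp: covariance_add_left ess_bounded_intros)

lemma covariance_sum_right:
  assumes "\<And>i. i \<in> I \<Longrightarrow> ess_bounded (Y i)" "ess_bounded Z"
  shows "covariance M Z (\<lambda>\<omega>. \<Sum>i\<in>I. Y i \<omega>) = (\<Sum>i\<in>I. covariance M Z (Y i))"
  using covariance_sum_left[OF assms] by (simp add: covariance_commute)

text \<open>Both E(YZ) and EY EZ are at most B E|Y| in modulus. The bound is asymmetric on purpose: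
  a factor that is small in L1 already makes the covariance small, which later allows an indicator
  to be exchanged for its smoothing.\<close>

lemma covariance_bound_left:
  assumes "ess_bounded Y" "ess_bounded Z" and B: "AE \<omega> in M. \<bar>Z \<omega>\<bar> \<le> B"
  shows "\<bar>covariance M Y Z\<bar> \<le> 2 * B * expectation (\<lambda>\<omega>. \<bar>Y \<omega>\<bar>)"
proof -
  have int: "integrable M Y" "integrable M Z" "integrable M (\<lambda>\<omega>. Y \<omega> * Z \<omega>)"
    using assms by (auto intro!: ess_bounded_integrable ess_bounded_intros)
  have "\<bar>expectation (\<lambda>\<omega>. Y \<omega> * Z \<omega>)\<bar> \<le> expectation (\<lambda>\<omega>. \<bar>Y \<omega> * Z \<omega>\<bar>)"
    by (rule integral_abs_bound)
  also have "\<dots> \<le> expectation (\<lambda>\<omega>. B * \<bar>Y \<omega>\<bar>)"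
    by (intro integral_mono_AE integrable_abs int integrable_mult_right eventually_mono[OF B])
       (simp add: abs_mult mult.commute[of "\<bar>Y _\<bar>"] mult_right_mono)
  finally have 1: "\<bar>expectation (\<lambda>\<omega>. Y \<omega> * Z \<omega>)\<bar> \<le> B * expectation (\<lambda>\<omega>. \<bar>Y \<omega>\<bar>)" by simp
  have "\<bar>expectation Z\<bar> \<le> expectation (\<lambda>\<omega>. \<bar>Z \<omega>\<bar>)" by (rule integral_abs_bound)
  also have "\<dots> \<le> expectation (\<lambda>\<omega>. B)" by (intro integral_mono_AE integrable_abs int B) simp
  finally have "\<bar>expectation Z\<bar> \<le> B" by (simp add: prob_space)
  then have "\<bar>expectation Y * expectation Z\<bar> \<le> expectation (\<lambda>\<omega>. \<bar>Y \<omega>\<bar>) * B"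
    unfolding abs_mult by (intro mult_mono integral_abs_bound) auto
  with 1 show ?thesis
    unfolding covariance_eq[OF assms(1,2)] by (simp add: mult.commute[of _ B])
qed

section \<open>Characteristic functions: L1 stability, Taylor expansion, factorisation\<close>

definition cf :: "('a \<Rightarrow> real) \<Rightarrow> real \<Rightarrow> complex" where
  "cf Y s = (CLINT \<omega>|M. iexp (s * Y \<omega>))"

lemma char_distr_eq_cf: "Y \<in> borel_measurable M \<Longrightarrow> char (distr M borel Y) s = cf Y s"
  unfolding char_def cf_def by (subst integral_distr) auto

lemma cf_integrable: "Y \<in> borel_measurable M \<Longrightarrow> integrable M (\<lambda>\<omega>. iexp (s * Y \<omega>))"
  by (rule integrable_const_bound[where B = 1]) auto

lemma norm_cf_le_1: "Y \<in> borel_measurable M \<Longrightarrow> norm (cf Y s) \<le> 1"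
  using prob_space_axioms
  by (metis char_distr_eq_cf prob_space.prob_space_distr real_distribution.cmod_char_le_1 real_distribution_def
    real_distribution_axioms.intro sets_distr sets_borel space_borel)

text \<open>The map \<open>iexp\<close> is 1-Lipschitz on the reals. This takes the place of a
  Slutsky argument: a perturbation that vanishes in L1 does not change the limit of characteristic
  functions at a fixed argument.\<close>

lemma cf_diff_le:
  assumes "ess_bounded Y" "ess_bounded Z"
  shows "norm (cf Y s - cf Z s) \<le> \<bar>s\<bar> * expectation (\<lambda>\<omega>. \<bar>Y \<omega> - Z \<omega>\<bar>)"
proof -
  have [measurable]: "Y \<in> borel_measurable M" "Z \<in> borel_measurable M"
    using assms by (auto dest: ess_bounded_measurable)
  have i: "integrable M (\<lambda>\<omega>. \<bar>Y \<omega> - Z \<omega>\<bar>)"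
    using assms by (intro integrable_abs ess_bounded_integrable ess_bounded_intros)
  have le: "norm (iexp (s * y) - iexp (s * z)) \<le> \<bar>s\<bar> * \<bar>y - z\<bar>" for y z :: real
  proof -
    \<comment> \<open>Splitting off a unimodular factor leaves the order-zero Taylor remainder at
      the origin.\<close>
    have "iexp (s * y) - iexp (s * z) = iexp (s * z) * (iexp (s * (y - z)) - 1)"
      by (simp add: algebra_simps exp_diff)
    then have "norm (iexp (s * y) - iexp (s * z)) = norm (iexp (s * (y - z)) - 1)"
      by (simp add: norm_mult del: of_real_mult of_real_diff)
    also have "\<dots> \<le> \<bar>s * (y - z)\<bar>" using iexp_approx1[of "s * (y - z)" 0] by simp
    finally show ?thesis by (simp add: abs_mult)
  qed
  have "cf Y s - cf Z s = (CLINT \<omega>|M. iexp (s * Y \<omega>) - iexp (s * Z \<omega>))"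
    unfolding cf_def by (intro Bochner_Integration.integral_diff[symmetric] cf_integrable) auto
  also have "norm \<dots> \<le> (LINT \<omega>|M. norm (iexp (s * Y \<omega>) - iexp (s * Z \<omega>)))"
    by (rule integral_norm_bound)
  also have "\<dots> \<le> (LINT \<omega>|M. \<bar>s\<bar> * \<bar>Y \<omega> - Z \<omega>\<bar>)"
    by (intro integral_mono le integrable_norm integrable_mult_right i
        Bochner_Integration.integrable_diff cf_integrable) measurable
  finally show ?thesis by simp
qed

text \<open>\<open>char_approx3'\<close> offers the minimum of a quadratic and a cubic remainder;
  the cubic one is kept and bounded through \<open>B\<close>. With \<open>s\<close> of order
  n^(-1/2), up to n such errors still sum to something that vanishes.\<close>

lemma cf_taylor:
  assumes Y: "Y \<in> borel_measurable M" and B: "AE \<omega> in M. \<bar>Y \<omega>\<bar> \<le> B"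
    and zero: "expectation Y = 0"
  shows "norm (cf Y s - (1 - s\<^sup>2 * covariance M Y Y / 2)) \<le> \<bar>s\<bar>^3 * B^3 / 6"
proof -
  have eb: "ess_bounded Y" using Y B by (rule ess_boundedI)
  have i: "integrable M Y" "integrable M (\<lambda>\<omega>. (Y \<omega>)\<^sup>2)"
    unfolding power2_eq_square using eb by (auto intro!: ess_bounded_integrable ess_bounded_intros)
  have v: "variance Y = covariance M Y Y"
    unfolding covariance_def by (simp add: power2_eq_square)
  have "norm (cf Y s - (1 - s\<^sup>2 * covariance M Y Y / 2))
      \<le> (s\<^sup>2 / 6) * expectation (\<lambda>\<omega>. min (6 * (Y \<omega>)\<^sup>2) (\<bar>s\<bar> * \<bar>Y \<omega>\<bar> ^ 3))"
    using char_approx3'[OF Y i zero v refl, of s] Y by (simp add: char_distr_eq_cf)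
  also have "\<dots> \<le> (s\<^sup>2 / 6) * expectation (\<lambda>\<omega>. \<bar>s\<bar> * B ^ 3)"
  proof (intro mult_left_mono integral_mono_AE)
    show "integrable M (\<lambda>\<omega>. min (6 * (Y \<omega>)\<^sup>2) (\<bar>s\<bar> * \<bar>Y \<omega>\<bar> ^ 3))"
      by (rule Bochner_Integration.integrable_bound[OF integrable_mult_right[OF i(2), of 6]]) (use Y in auto)
    show "AE \<omega> in M. min (6 * (Y \<omega>)\<^sup>2) (\<bar>s\<bar> * \<bar>Y \<omega>\<bar> ^ 3) \<le> \<bar>s\<bar> * B ^ 3"
      using B by eventually_elim (auto intro!: min.coboundedI2 mult_left_mono power_mono)
  qed auto
  also have "\<dots> = \<bar>s\<bar>^3 * B^3 / 6"
    by (simp add: prob_space power3_eq_cube[of "\<bar>s\<bar>"] power2_eq_square)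
  finally show ?thesis by simp
qed

text \<open>By the addition theorems the real part of the difference is Cov(cos, cos) - Cov(sin,
  sin) and the imaginary part Cov(sin, cos) + Cov(cos, sin). These are covariances of real
  functions, the form that association can bound.\<close>

lemma cf_add_diff:
  assumes "ess_bounded Y" "ess_bounded Z"
    and "\<bar>covariance M (\<lambda>\<omega>. cos (s * Y \<omega>)) (\<lambda>\<omega>. cos (s * Z \<omega>))\<bar> \<le> D"
    and "\<bar>covariance M (\<lambda>\<omega>. sin (s * Y \<omega>)) (\<lambda>\<omega>. sin (s * Z \<omega>))\<bar> \<le> D"
    and "\<bar>covariance M (\<lambda>\<omega>. sin (s * Y \<omega>)) (\<lambda>\<omega>. cos (s * Z \<omega>))\<bar> \<le> D"
    and "\<bar>covariance M (\<lambda>\<omega>. cos (s * Y \<omega>)) (\<lambda>\<omega>. sin (s * Z \<omega>))\<bar> \<le> D"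
  shows "norm (cf (\<lambda>\<omega>. Y \<omega> + Z \<omega>) s - cf Y s * cf Z s) \<le> 4 * D"
proof -
  have cfC: "cf W s = Complex (expectation (\<lambda>\<omega>. cos (s * W \<omega>))) (expectation (\<lambda>\<omega>. sin (s * W \<omega>)))"
    if "ess_bounded W" for W
    using cf_integrable[OF ess_bounded_measurable[OF that], of s]
    by (simp add: complex_eq_iff cf_def flip: integral_Re integral_Im) (simp add: Re_exp Im_exp)
  have i: "integrable M (\<lambda>\<omega>. cos (s * Y \<omega>) * cos (s * Z \<omega>))"
     "integrable M (\<lambda>\<omega>. sin (s * Y \<omega>) * sin (s * Z \<omega>))"
     "integrable M (\<lambda>\<omega>. sin (s * Y \<omega>) * cos (s * Z \<omega>))"
     "integrable M (\<lambda>\<omega>. cos (s * Y \<omega>) * sin (s * Z \<omega>))"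
    using assms by (auto intro!: ess_bounded_integrable ess_bounded_intros)
  have "cf (\<lambda>\<omega>. Y \<omega> + Z \<omega>) s - cf Y s * cf Z s =
     Complex (covariance M (\<lambda>\<omega>. cos (s * Y \<omega>)) (\<lambda>\<omega>. cos (s * Z \<omega>))
              - covariance M (\<lambda>\<omega>. sin (s * Y \<omega>)) (\<lambda>\<omega>. sin (s * Z \<omega>)))
       (covariance M (\<lambda>\<omega>. sin (s * Y \<omega>)) (\<lambda>\<omega>. cos (s * Z \<omega>))
              + covariance M (\<lambda>\<omega>. cos (s * Y \<omega>)) (\<lambda>\<omega>. sin (s * Z \<omega>)))"
    using assms(1,2) i
    by (simp add: cfC ess_bounded_intros covariance_eq complex_eq_iff ring_distribs cos_add sin_add)
  then show ?thesis
    using cmod_le[of "cf (\<lambda>\<omega>. Y \<omega> + Z \<omega>) s - cf Y s * cf Z s"] assms(3-) by simp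
qed

end

section \<open>Associated stationary sequences\<close>

lemma Cesaro_mean_tendsto:
  fixes a :: "nat \<Rightarrow> real"
  assumes "a \<longlonglongrightarrow> L"
  shows "(\<lambda>n. (\<Sum>k<n. a k) / real n) \<longlonglongrightarrow> L"
proof (rule LIMSEQ_I)
  fix e :: real assume "e > 0"
  then obtain N where N: "\<And>k. k \<ge> N \<Longrightarrow> \<bar>a k - L\<bar> < e / 2"
    using LIMSEQ_D[OF assms, of "e / 2"] by auto
  define K where "K = (\<Sum>k<N. \<bar>a k - L\<bar>)"
  \<comment> \<open>The ceiling term makes the fixed head \<open>K\<close> smaller than
    \<open>n * e / 2\<close>; each of the later deviations is below \<open>e / 2\<close>.\<close>
  have "norm ((\<Sum>k<n. a k) / real n - L) < e" if n: "n > N + nat \<lceil>2 * K / e\<rceil>" for n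
  proof -
    have "(\<Sum>k<n. \<bar>a k - L\<bar>) = K + (\<Sum>k=N..<n. \<bar>a k - L\<bar>)"
      unfolding K_def lessThan_atLeast0 using n by (simp add: sum.atLeastLessThan_concat)
    also have "(\<Sum>k=N..<n. \<bar>a k - L\<bar>) \<le> (\<Sum>k=N..<n. e / 2)"
      by (intro sum_mono) (use N in \<open>auto intro: less_imp_le\<close>)
    also have "\<dots> \<le> real n * (e / 2)" using \<open>e > 0\<close> by simp
    also have "K < real n * (e / 2)"
    proof -
      have "2 * K / e < real n" using n by linarith
      with \<open>e > 0\<close> show ?thesis by (simp add: field_simps)
    qed
    finally have "(\<Sum>k<n. \<bar>a k - L\<bar>) < real n * e" by (simp add: mult.commute)
    moreover have "\<bar>\<Sum>k<n. a k - L\<bar> \<le> (\<Sum>k<n. \<bar>a k - L\<bar>)" by (rule sum_abs)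
    ultimately have "\<bar>(\<Sum>k<n. a k) - real n * L\<bar> < real n * e" by (simp add: sum_subtractf)
    moreover have "real n > 0" using n by simp
    ultimately show ?thesis
      by (simp add: field_simps abs_less_iff)
  qed
  then show "\<exists>no. \<forall>n\<ge>no. norm ((\<Sum>k<n. a k) / real n - L) < e"
    by (intro exI[of _ "Suc (N + nat \<lceil>2 * K / e\<rceil>)"]) auto
qed

lemma abs_cos_diff_le: "\<bar>cos x - cos y\<bar> \<le> \<bar>x - y\<bar>" for x y :: real
proof -
  have "\<bar>cos x - cos y\<bar> = 2 * \<bar>sin ((x + y) / 2)\<bar> * \<bar>sin ((y - x) / 2)\<bar>"
    by (simp add: cos_diff_cos abs_mult)
  also have "\<dots> \<le> 2 * 1 * \<bar>(y - x) / 2\<bar>"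
    by (intro mult_mono abs_sin_x_le_abs_x) auto
  finally show ?thesis by simp
qed

lemma abs_sin_diff_le: "\<bar>sin x - sin y\<bar> \<le> \<bar>x - y\<bar>" for x y :: real
  using abs_cos_diff_le[of "pi / 2 - x" "pi / 2 - y"] by (simp add: cos_diff)

locale assoc_sequence = prob_space M for M :: "'a measure" +
  fixes X :: "nat \<Rightarrow> 'a \<Rightarrow> real" and C :: real
  assumes X_measurable: "n \<ge> 1 \<Longrightarrow> X n \<in> borel_measurable M"
    and stationary: "strictly_stationary M X"
    and assoc: "associated M {1..} X"
    and X_bound: "n \<ge> 1 \<Longrightarrow> AE \<omega> in M. \<bar>X n \<omega>\<bar> \<le> C"
begin

section \<open>Shift invariance from stationarity, and covariance bounds from association\<close>

definition c :: "nat \<Rightarrow> real" where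
  "c j = covariance M (X 1) (X (Suc j))"

lemma X_ess_bounded: "n \<ge> 1 \<Longrightarrow> ess_bounded (X n)"
  using X_measurable X_bound by (blast intro: ess_boundedI)

text \<open>Banach-valued because it is applied both to complex exponentials and to real
  products.\<close>

lemma expectation_shift:
  fixes \<phi> :: "(nat \<Rightarrow> real) \<Rightarrow> 'b::{banach, second_countable_topology}"
  assumes I: "finite I" "I \<subseteq> {1..}"
    and [measurable]: "(\<lambda>x. \<phi> x) \<in> borel_measurable (\<Pi>\<^sub>M i\<in>I. borel)"
  shows "(LINT \<omega>|M. \<phi> (\<lambda>i\<in>I. X (i + k) \<omega>)) = (LINT \<omega>|M. \<phi> (\<lambda>i\<in>I. X i \<omega>))"
proof -
  have m: "(\<lambda>\<omega>. \<lambda>i\<in>I. X (i + k) \<omega>) \<in> M \<rightarrow>\<^sub>M (\<Pi>\<^sub>M i\<in>I. borel)" for k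
    using I by (intro measurable_restrict X_measurable) auto
  have "(LINT \<omega>|M. \<phi> (\<lambda>i\<in>I. X (i + k) \<omega>))
      = integral\<^sup>L (distr M (\<Pi>\<^sub>M i\<in>I. borel) (\<lambda>\<omega>. \<lambda>i\<in>I. X (i + k) \<omega>)) \<phi>"
    by (subst integral_distr[OF m]) auto
  also have "\<dots> = integral\<^sup>L (distr M (\<Pi>\<^sub>M i\<in>I. borel) (\<lambda>\<omega>. \<lambda>i\<in>I. X i \<omega>)) \<phi>"
    using stationary I unfolding strictly_stationary_def by simp
  also have "\<dots> = (LINT \<omega>|M. \<phi> (\<lambda>i\<in>I. X i \<omega>))"
    using m[of 0] by (subst integral_distr) auto
  finally show ?thesis .
qed

lemma cf_shift:
  assumes I: "finite I" "I \<subseteq> {1..}" and [measurable]: "\<phi> \<in> borel_measurable borel"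
  shows "cf (\<lambda>\<omega>. \<Sum>i\<in>I. \<phi> (X (i + k) \<omega>)) s = cf (\<lambda>\<omega>. \<Sum>i\<in>I. \<phi> (X i \<omega>)) s"
proof -
  have "(\<lambda>x. iexp (s * (\<Sum>i\<in>I. \<phi> (x i)))) \<in> borel_measurable (\<Pi>\<^sub>M i\<in>I. borel)"
    by measurable
  from expectation_shift[OF I this, of k] show ?thesis
    unfolding cf_def by (simp cong: sum.cong)
qed

lemma expectation_shift_1:
  assumes [measurable]: "g \<in> borel_measurable borel" and "i \<ge> 1"
  shows "expectation (\<lambda>\<omega>. g (X (i + k) \<omega>)) = expectation (\<lambda>\<omega>. g (X i \<omega>) :: real)"
proof -
  have "(\<lambda>x. g (x i)) \<in> borel_measurable (\<Pi>\<^sub>M j\<in>{i}. borel)" by measurable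
  from expectation_shift[OF _ _ this, of k] show ?thesis using \<open>i \<ge> 1\<close> by simp
qed

lemma expectation_marginal:
  assumes "g \<in> borel_measurable borel" "i \<ge> 1"
  shows "expectation (\<lambda>\<omega>. g (X i \<omega>)) = expectation (\<lambda>\<omega>. g (X 1 \<omega>) :: real)"
  using expectation_shift_1[OF assms(1), of 1 "i - 1"] assms(2) by simp

lemma covariance_shift:
  assumes [measurable]: "g \<in> borel_measurable borel" "h \<in> borel_measurable borel"
    and ij: "i \<ge> 1" "j \<ge> 1"
  shows "covariance M (\<lambda>\<omega>. g (X (i + k) \<omega>)) (\<lambda>\<omega>. h (X (j + k) \<omega>))
       = covariance M (\<lambda>\<omega>. g (X i \<omega>)) (\<lambda>\<omega>. h (X j \<omega>))"
proof -
  \<comment> \<open>The centring constants stay free here; the means to be inserted are themselves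
    shift invariant by \<open>expectation_shift_1\<close>.\<close>
  have "(\<lambda>x. (g (x i) - a) * (h (x j) - b)) \<in> borel_measurable (\<Pi>\<^sub>M j\<in>{i, j}. borel)" for a b :: real
    by measurable
  from expectation_shift[OF _ _ this, of k] show ?thesis
    using ij unfolding covariance_def by (simp add: expectation_shift_1)
qed

lemma covariance_lag:
  assumes "g \<in> borel_measurable borel" "h \<in> borel_measurable borel" "1 \<le> i" "i \<le> j"
  shows "covariance M (\<lambda>\<omega>. g (X i \<omega>)) (\<lambda>\<omega>. h (X j \<omega>))
       = covariance M (\<lambda>\<omega>. g (X 1 \<omega>)) (\<lambda>\<omega>. h (X (Suc (j - i)) \<omega>))"
  using covariance_shift[OF assms(1,2), of 1 "Suc (j - i)" "i - 1"] assms(3,4) by simp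

lemma covariance_X: "1 \<le> i \<Longrightarrow> i \<le> j \<Longrightarrow> covariance M (X i) (X j) = c (j - i)"
  using covariance_lag[of "\<lambda>x. x" "\<lambda>x. x" i j] by (simp add: c_def)

text \<open>Transfers association from extensional vectors on \<open>I\<close> to functions of whole
  sequences, so that later arguments can pick coordinates and form sums freely. Essential
  boundedness guarantees that the covariance exists.\<close>

lemma covariance_mono_nonneg:
  assumes I: "finite I" "I \<subseteq> {1..}"
    and u: "\<And>x y. (\<And>i. i \<in> I \<Longrightarrow> x i \<le> y i) \<Longrightarrow> u x \<le> u y"
    and v: "\<And>x y. (\<And>i. i \<in> I \<Longrightarrow> x i \<le> y i) \<Longrightarrow> v x \<le> v y"
    and eb: "ess_bounded (\<lambda>\<omega>. u (\<lambda>i. X i \<omega>))" "ess_bounded (\<lambda>\<omega>. v (\<lambda>i. X i \<omega>))"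
  shows "covariance M (\<lambda>\<omega>. u (\<lambda>i. X i \<omega>)) (\<lambda>\<omega>. v (\<lambda>i. X i \<omega>)) \<ge> 0"
proof -
  \<comment> \<open>Used in both directions on points that agree on \<open>I\<close>, monotonicity
    shows that \<open>u\<close> and \<open>v\<close> ignore all coordinates outside
    \<open>I\<close>.\<close>
  have ur: "u (\<lambda>i\<in>I. X i \<omega>) = u (\<lambda>i. X i \<omega>)" and vr: "v (\<lambda>i\<in>I. X i \<omega>) = v (\<lambda>i. X i \<omega>)" for \<omega>
    by (intro order_antisym u v; simp)+
  have exists: "covariance_exists M (\<lambda>\<omega>. u (\<lambda>i\<in>I. X i \<omega>)) (\<lambda>\<omega>. v (\<lambda>i\<in>I. X i \<omega>))"
    unfolding covariance_exists_def ur vr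
    using eb by (simp add: ess_bounded_integrable ess_bounded_mult)
  have mono: "mono_on (I \<rightarrow>\<^sub>E UNIV) u" "mono_on (I \<rightarrow>\<^sub>E UNIV) v"
    by (auto intro!: mono_onI u v simp: le_fun_def)
  have "associated_finite M I X"
    using assoc I unfolding associated_def by blast
  from this[unfolded associated_finite_def, rule_format, OF mono exists]
  show ?thesis unfolding ur vr .
qed

text \<open>If h changes by at most as much as the increasing H does, then H + h and
  H - h are increasing, and association applies to them.\<close>

lemma covariance_dominated:
  assumes I: "finite I" "I \<subseteq> {1..}"
    and h: "\<And>x y. (\<And>i. i \<in> I \<Longrightarrow> x i \<le> y i) \<Longrightarrow> \<bar>h y - h x\<bar> \<le> H y - H x"
    and g: "\<And>x y. (\<And>i. i \<in> I \<Longrightarrow> x i \<le> y i) \<Longrightarrow> \<bar>g y - g x\<bar> \<le> G y - G x"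
    and eb: "ess_bounded (\<lambda>\<omega>. h (\<lambda>i. X i \<omega>))" "ess_bounded (\<lambda>\<omega>. H (\<lambda>i. X i \<omega>))"
      "ess_bounded (\<lambda>\<omega>. g (\<lambda>i. X i \<omega>))" "ess_bounded (\<lambda>\<omega>. G (\<lambda>i. X i \<omega>))"
  shows "\<bar>covariance M (\<lambda>\<omega>. h (\<lambda>i. X i \<omega>)) (\<lambda>\<omega>. g (\<lambda>i. X i \<omega>))\<bar>
      \<le> covariance M (\<lambda>\<omega>. H (\<lambda>i. X i \<omega>)) (\<lambda>\<omega>. G (\<lambda>i. X i \<omega>))"
proof -
  have mono: "H x + h x \<le> H y + h y" "H x - h x \<le> H y - h y"
       "G x + g x \<le> G y + g y" "G x - g x \<le> G y - g y"
    if "\<And>i. i \<in> I \<Longrightarrow> x i \<le> y i" for x y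
    using h[of x y] g[of x y] that by auto
  let ?at = "\<lambda>f \<omega>. f (\<lambda>i. X i \<omega>)"
  \<comment> \<open>After expansion the first two inequalities add up to Cov(h, g) \<le> Cov(H, G),
    the last two to -Cov(h, g) \<le> Cov(H, G).\<close>
  have "0 \<le> covariance M (\<lambda>\<omega>. ?at H \<omega> + ?at h \<omega>) (\<lambda>\<omega>. ?at G \<omega> - ?at g \<omega>)"
    by (rule covariance_mono_nonneg[OF I, where u = "\<lambda>x. H x + h x" and v = "\<lambda>x. G x - g x"])
       (intro mono(1) mono(4) ess_bounded_intros eb; assumption)+
  moreover have "0 \<le> covariance M (\<lambda>\<omega>. ?at H \<omega> - ?at h \<omega>) (\<lambda>\<omega>. ?at G \<omega> + ?at g \<omega>)"
    by (rule covariance_mono_nonneg[OF I, where u = "\<lambda>x. H x - h x" and v = "\<lambda>x. G x + g x"])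
       (intro mono(2) mono(3) ess_bounded_intros eb; assumption)+
  moreover have "0 \<le> covariance M (\<lambda>\<omega>. ?at H \<omega> + ?at h \<omega>) (\<lambda>\<omega>. ?at G \<omega> + ?at g \<omega>)"
    by (rule covariance_mono_nonneg[OF I, where u = "\<lambda>x. H x + h x" and v = "\<lambda>x. G x + g x"])
       (intro mono(1) mono(3) ess_bounded_intros eb; assumption)+
  moreover have "0 \<le> covariance M (\<lambda>\<omega>. ?at H \<omega> - ?at h \<omega>) (\<lambda>\<omega>. ?at G \<omega> - ?at g \<omega>)"
    by (rule covariance_mono_nonneg[OF I, where u = "\<lambda>x. H x - h x" and v = "\<lambda>x. G x - g x"])
       (intro mono(2) mono(4) ess_bounded_intros eb; assumption)+
  ultimately show ?thesis
    using eb by (simp add: ess_bounded_intros covariance_add_left covariance_diff_left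
        covariance_add_right covariance_diff_right)
qed

lemma c_nonneg: "c j \<ge> 0"
  using covariance_mono_nonneg[of "{1, Suc j}" "\<lambda>x. x 1" "\<lambda>x. x (Suc j)"]
  by (simp add: c_def X_ess_bounded)

lemma lipschitz_measurable:
  fixes \<phi> :: "real \<Rightarrow> real"
  assumes "\<And>x y. \<bar>\<phi> x - \<phi> y\<bar> \<le> \<bar>x - y\<bar>"
  shows "\<phi> \<in> borel_measurable borel"
proof (intro borel_measurable_continuous_onI continuous_on_iff[THEN iffD2] ballI allI impI)
  fix x e :: real assume "e > 0"
  then show "\<exists>d>0. \<forall>x'\<in>UNIV. dist x' x < d \<longrightarrow> dist (\<phi> x') (\<phi> x) < e"
    using assms by (intro exI[of _ e]) (auto simp: dist_real_def intro: le_less_trans)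
qed

lemma lipschitz_bound:
  assumes "\<And>x y. \<bar>\<phi> x - \<phi> y\<bar> \<le> \<bar>x - y :: real\<bar>" and "n \<ge> 1"
  shows "AE \<omega> in M. \<bar>\<phi> (X n \<omega>)\<bar> \<le> \<bar>\<phi> 0\<bar> + C"
  using X_bound[OF \<open>n \<ge> 1\<close>]
proof eventually_elim
  case (elim \<omega>)
  with assms(1)[of "X n \<omega>" 0] show ?case by linarith
qed

lemma lipschitz_ess_bounded:
  assumes "\<And>x y. \<bar>\<phi> x - \<phi> y\<bar> \<le> \<bar>x - y :: real\<bar>" and "n \<ge> 1"
  shows "ess_bounded (\<lambda>\<omega>. \<phi> (X n \<omega>))"
  using lipschitz_bound[of \<phi> n] lipschitz_measurable[of \<phi>] X_measurable[of n] assms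
  by (intro ess_boundedI) auto

text \<open>Domination with the coordinates themselves as \<open>H\<close> and \<open>G\<close>,
  since a 1-Lipschitz function moves no more than its argument. Summability thus passes from
  \<open>c\<close> to the covariances of the projected kernel.\<close>

lemma lipschitz_covariance_le:
  assumes lip: "\<And>x y. \<bar>\<phi> x - \<phi> y\<bar> \<le> \<bar>x - y :: real\<bar>"
  shows "\<bar>covariance M (\<lambda>\<omega>. \<phi> (X 1 \<omega>)) (\<lambda>\<omega>. \<phi> (X (Suc j) \<omega>))\<bar> \<le> c j"
proof -
  have *: "\<bar>\<phi> y - \<phi> x\<bar> \<le> y - x" if "x \<le> y" for x y
    using lip[of y x] that by simp
  show ?thesis
    using covariance_dominated[of "{1, Suc j}" "\<lambda>x. \<phi> (x 1)" "\<lambda>x. x 1" "\<lambda>x. \<phi> (x (Suc j))" "\<lambda>x. x (Suc j)"]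
    by (simp add: c_def X_ess_bounded lipschitz_ess_bounded[OF lip] *)
qed

text \<open>Newman's inequality. Cosine and sine of \<open>s\<close> times a sum of 1-Lipschitz
  terms change by at most \<open>\<bar>s\<bar>\<close> times the increase of the sum of the
  coordinates, so domination and bilinearity bound each of the four covariances by the same double
  sum.\<close>

lemma cf_sum_diff:
  assumes lip: "\<And>x y. \<bar>\<phi> x - \<phi> y\<bar> \<le> \<bar>x - y :: real\<bar>"
    and I: "finite I" "I \<subseteq> {1..}" and J: "finite J" "J \<subseteq> {1..}"
  shows "norm (cf (\<lambda>\<omega>. (\<Sum>i\<in>I. \<phi> (X i \<omega>)) + (\<Sum>i\<in>J. \<phi> (X i \<omega>))) s
            - cf (\<lambda>\<omega>. \<Sum>i\<in>I. \<phi> (X i \<omega>)) s * cf (\<lambda>\<omega>. \<Sum>i\<in>J. \<phi> (X i \<omega>)) s)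
      \<le> 4 * (s\<^sup>2 * (\<Sum>i\<in>I. \<Sum>j\<in>J. covariance M (X i) (X j)))"
proof (rule cf_add_diff)
  have sub: "A \<subseteq> {1..} \<Longrightarrow> i \<in> A \<Longrightarrow> i \<ge> 1" for A and i :: nat by auto
  have ebX: "ess_bounded (\<lambda>\<omega>. \<Sum>i\<in>A. X i \<omega>)" if "A \<subseteq> {1..}" for A
    using that by (intro ess_bounded_sum X_ess_bounded) auto
  show eb: "ess_bounded (\<lambda>\<omega>. \<Sum>i\<in>I. \<phi> (X i \<omega>))" "ess_bounded (\<lambda>\<omega>. \<Sum>i\<in>J. \<phi> (X i \<omega>))"
    using I J by (auto intro!: ess_bounded_sum lipschitz_ess_bounded lip)
  \<comment> \<open>\<open>tr\<close> stands for cosine or sine. Only its Lipschitz constant 1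
    enters, so one estimate serves all four combinations.\<close>
  have dom: "\<bar>tr (s * (\<Sum>i\<in>A. \<phi> (y i))) - tr (s * (\<Sum>i\<in>A. \<phi> (x i)))\<bar>
       \<le> \<bar>s\<bar> * (\<Sum>i\<in>A. y i) - \<bar>s\<bar> * (\<Sum>i\<in>A. x i)"
    if "\<And>i. i \<in> I \<union> J \<Longrightarrow> x i \<le> y i" "A \<subseteq> I \<union> J" "\<And>u v. \<bar>tr u - tr v\<bar> \<le> \<bar>u - v\<bar>"
    for x y :: "nat \<Rightarrow> real" and A and tr :: "real \<Rightarrow> real"
  proof -
    have "\<bar>\<Sum>i\<in>A. \<phi> (y i) - \<phi> (x i)\<bar> \<le> (\<Sum>i\<in>A. \<bar>\<phi> (y i) - \<phi> (x i)\<bar>)" by (rule sum_abs)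
    also have "\<dots> \<le> (\<Sum>i\<in>A. y i - x i)"
    proof (rule sum_mono)
      fix i assume "i \<in> A"
      with that have "x i \<le> y i" by auto
      with lip[of "y i" "x i"] show "\<bar>\<phi> (y i) - \<phi> (x i)\<bar> \<le> y i - x i" by simp
    qed
    finally have 1: "\<bar>\<Sum>i\<in>A. \<phi> (y i) - \<phi> (x i)\<bar> \<le> (\<Sum>i\<in>A. y i - x i)" .
    have "\<bar>tr (s * (\<Sum>i\<in>A. \<phi> (y i))) - tr (s * (\<Sum>i\<in>A. \<phi> (x i)))\<bar>
        \<le> \<bar>s * (\<Sum>i\<in>A. \<phi> (y i)) - s * (\<Sum>i\<in>A. \<phi> (x i))\<bar>" by (rule that)
    also have "\<dots> = \<bar>s\<bar> * \<bar>\<Sum>i\<in>A. \<phi> (y i) - \<phi> (x i)\<bar>"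
      by (simp only: sum_subtractf right_diff_distrib[symmetric] abs_mult)
    also have "\<dots> \<le> \<bar>s\<bar> * (\<Sum>i\<in>A. y i - x i)" by (intro mult_left_mono 1) simp
    finally show ?thesis by (simp only: sum_subtractf right_diff_distrib)
  qed
  have cov: "covariance M (\<lambda>\<omega>. \<bar>s\<bar> * (\<Sum>i\<in>I. X i \<omega>)) (\<lambda>\<omega>. \<bar>s\<bar> * (\<Sum>i\<in>J. X i \<omega>))
      = s\<^sup>2 * (\<Sum>i\<in>I. \<Sum>j\<in>J. covariance M (X i) (X j))"
    using I J sub by (simp add: covariance_scale_left covariance_scale_right covariance_sum_left
        covariance_sum_right X_ess_bounded ebX power2_eq_square)
  have gen: "\<bar>covariance M (\<lambda>\<omega>. tr (s * (\<Sum>i\<in>I. \<phi> (X i \<omega>)))) (\<lambda>\<omega>. tr' (s * (\<Sum>i\<in>J. \<phi> (X i \<omega>))))\<bar>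
     \<le> s\<^sup>2 * (\<Sum>i\<in>I. \<Sum>j\<in>J. covariance M (X i) (X j))"
    if "\<And>u v. \<bar>tr u - tr v\<bar> \<le> \<bar>u - v\<bar>" "\<And>u v. \<bar>tr' u - tr' v\<bar> \<le> \<bar>u - v\<bar>"
      "ess_bounded (\<lambda>\<omega>. tr (s * (\<Sum>i\<in>I. \<phi> (X i \<omega>))))"
      "ess_bounded (\<lambda>\<omega>. tr' (s * (\<Sum>i\<in>J. \<phi> (X i \<omega>))))" for tr tr'
    unfolding cov[symmetric]
  proof (rule covariance_dominated[where I = "I \<union> J"
        and h = "\<lambda>x. tr (s * (\<Sum>i\<in>I. \<phi> (x i)))" and H = "\<lambda>x. \<bar>s\<bar> * (\<Sum>i\<in>I. x i)"
        and g = "\<lambda>x. tr' (s * (\<Sum>i\<in>J. \<phi> (x i)))" and G = "\<lambda>x. \<bar>s\<bar> * (\<Sum>i\<in>J. x i)"])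
    show "finite (I \<union> J)" "I \<union> J \<subseteq> {1..}" using I J by auto
    show "ess_bounded (\<lambda>\<omega>. \<bar>s\<bar> * (\<Sum>i\<in>I. X i \<omega>))" "ess_bounded (\<lambda>\<omega>. \<bar>s\<bar> * (\<Sum>i\<in>J. X i \<omega>))"
      using I J by (simp_all add: ess_bounded_mult ebX)
  qed (rule dom, assumption, rule Un_upper1, rule that(1),
       rule dom, assumption, rule Un_upper2, rule that(2), rule that(3), rule that(4))
  note b = abs_cos_diff_le abs_sin_diff_le ess_bounded_cos[OF eb(1)] ess_bounded_cos[OF eb(2)]
     ess_bounded_sin[OF eb(1)] ess_bounded_sin[OF eb(2)]
  show "\<bar>covariance M (\<lambda>\<omega>. cos (s * (\<Sum>i\<in>I. \<phi> (X i \<omega>)))) (\<lambda>\<omega>. cos (s * (\<Sum>i\<in>J. \<phi> (X i \<omega>))))\<bar>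
     \<le> s\<^sup>2 * (\<Sum>i\<in>I. \<Sum>j\<in>J. covariance M (X i) (X j))" by (rule gen b)+
  show "\<bar>covariance M (\<lambda>\<omega>. sin (s * (\<Sum>i\<in>I. \<phi> (X i \<omega>)))) (\<lambda>\<omega>. sin (s * (\<Sum>i\<in>J. \<phi> (X i \<omega>))))\<bar>
     \<le> s\<^sup>2 * (\<Sum>i\<in>I. \<Sum>j\<in>J. covariance M (X i) (X j))" by (rule gen b)+
  show "\<bar>covariance M (\<lambda>\<omega>. sin (s * (\<Sum>i\<in>I. \<phi> (X i \<omega>)))) (\<lambda>\<omega>. cos (s * (\<Sum>i\<in>J. \<phi> (X i \<omega>))))\<bar>
     \<le> s\<^sup>2 * (\<Sum>i\<in>I. \<Sum>j\<in>J. covariance M (X i) (X j))" by (rule gen b)+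
  show "\<bar>covariance M (\<lambda>\<omega>. cos (s * (\<Sum>i\<in>I. \<phi> (X i \<omega>)))) (\<lambda>\<omega>. sin (s * (\<Sum>i\<in>J. \<phi> (X i \<omega>))))\<bar>
     \<le> s\<^sup>2 * (\<Sum>i\<in>I. \<Sum>j\<in>J. covariance M (X i) (X j))" by (rule gen b)+
qed

end

locale summable_assoc_sequence = assoc_sequence +
  assumes summable_c: "summable c"
begin

text \<open>Bounds the total covariance between \<open>l\<close> consecutive observations and
  everything before them; the inner series at \<open>q\<close> is the tail of the lags from
  \<open>q + 1\<close> on.\<close>

definition R :: "nat \<Rightarrow> real" where
  "R l = (\<Sum>q<l. \<Sum>n. c (n + Suc q))"

text \<open>Observation \<open>m + 1 + q\<close> lies at lags q + 1, ..., q + m from the first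
  \<open>m\<close> ones. As \<open>c\<close> is nonnegative, passing to the infinite tail gives a
  bound that is uniform in \<open>m\<close>.\<close>

lemma covariance_blocks_le: "(\<Sum>i\<in>{1..m}. \<Sum>j\<in>{m + 1..m + l}. covariance M (X i) (X j)) \<le> R l"
proof -
  have "(\<Sum>i\<in>{1..m}. \<Sum>j\<in>{m + 1..m + l}. covariance M (X i) (X j))
      = (\<Sum>j\<in>{m + 1..m + l}. \<Sum>i\<in>{1..m}. covariance M (X i) (X j))"
    by (rule sum.swap)
  also have "\<dots> = (\<Sum>j\<in>{m + 1..m + l}. \<Sum>i\<in>{1..m}. c (j - i))"
    by (intro sum.cong refl covariance_X) auto
  also have "\<dots> = (\<Sum>q<l. \<Sum>i\<in>{1..m}. c (q + Suc m - i))"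
    by (rule sum.reindex_bij_witness[of _ "\<lambda>q. q + Suc m" "\<lambda>j. j - Suc m"]) auto
  also have "\<dots> = (\<Sum>q<l. \<Sum>n<m. c (n + Suc q))"
    by (rule sum.cong[OF refl], rule sum.reindex_bij_witness[of _ "\<lambda>n. m - n" "\<lambda>i. m - i"])
       (auto simp: Suc_diff_le add.commute)
  also have "\<dots> \<le> R l"
    unfolding R_def by (intro sum_mono sum_le_suminf summable_ignore_initial_segment summable_c c_nonneg) auto
  finally show ?thesis .
qed

text \<open>\<open>R l / l\<close> is an average of tails of a convergent series. About n/l blocks,
  each with Newman error of order \<open>R l / n\<close>, cost \<open>R l / l\<close> in total, so
  long blocks make this error small.\<close>

lemma R_tendsto: "(\<lambda>l. R l / real l) \<longlonglongrightarrow> 0"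
proof -
  have "(\<lambda>q. \<Sum>n. c (n + q)) \<longlonglongrightarrow> 0"
    by (rule suminf_exist_split2[OF summable_c])
  then have "(\<lambda>q. \<Sum>n. c (n + Suc q)) \<longlonglongrightarrow> 0" by (rule LIMSEQ_Suc)
  from Cesaro_mean_tendsto[OF this] show ?thesis by (simp add: R_def)
qed

definition S :: "(real \<Rightarrow> real) \<Rightarrow> nat \<Rightarrow> 'a \<Rightarrow> real" where
  "S \<phi> n \<omega> = (\<Sum>i\<in>{1..n}. \<phi> (X i \<omega>))"

lemma S_ess_bounded:
  assumes lip: "\<And>x y. \<bar>\<phi> x - \<phi> y\<bar> \<le> \<bar>x - y :: real\<bar>"
  shows "ess_bounded (S \<phi> n)"
  unfolding S_def[abs_def] by (intro ess_bounded_sum lipschitz_ess_bounded lip) auto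

text \<open>Blocks are split off one at a time, each at the price of one Newman error. The
  characteristic function of a block has modulus at most 1, so earlier errors are not amplified and
  the \<open>k\<close> errors simply add.\<close>

lemma cf_S_power:
  assumes lip: "\<And>x y. \<bar>\<phi> x - \<phi> y\<bar> \<le> \<bar>x - y :: real\<bar>"
  shows "norm (cf (S \<phi> (k * l)) s - cf (S \<phi> l) s ^ k) \<le> real k * (4 * (s\<^sup>2 * R l))"
proof (induction k)
  case 0
  have "cf (S \<phi> 0) s = 1" unfolding cf_def S_def by (simp add: prob_space)
  then show ?case by simp
next
  case (Suc k)
  let ?z = "cf (S \<phi> l) s"
  have z: "norm ?z \<le> 1"
    by (intro norm_cf_le_1 ess_bounded_measurable S_ess_bounded lip)
  have split: "S \<phi> (Suc k * l) = (\<lambda>\<omega>. (\<Sum>i\<in>{1..k * l}. \<phi> (X i \<omega>)) + (\<Sum>i\<in>{k * l + 1..k * l + l}. \<phi> (X i \<omega>)))"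
  proof -
    have "Suc k * l = k * l + l" by simp
    then show ?thesis unfolding S_def by (simp only:) (rule ext, rule sum.ub_add_nat, simp)
  qed
  \<comment> \<open>Stationarity moves the last block to the first \<open>l\<close> indices, so its
    characteristic function is \<open>?z\<close>.\<close>
  have "(\<lambda>\<omega>. \<Sum>i\<in>{k * l + 1..k * l + l}. \<phi> (X i \<omega>)) = (\<lambda>\<omega>. \<Sum>i\<in>{1..l}. \<phi> (X (i + k * l) \<omega>))"
    by (rule ext, rule sum.reindex_bij_witness[of _ "\<lambda>i. i + k * l" "\<lambda>j. j - k * l"]) auto
  then have "cf (\<lambda>\<omega>. \<Sum>i\<in>{k * l + 1..k * l + l}. \<phi> (X i \<omega>)) s = ?z"
    using cf_shift[of "{1..l}" \<phi> "k * l" s] lipschitz_measurable[OF lip]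
    by (simp add: S_def[abs_def])
  with cf_sum_diff[OF lip, of "{1..k * l}" "{k * l + 1..k * l + l}" s]
  have "norm (cf (S \<phi> (Suc k * l)) s - cf (S \<phi> (k * l)) s * ?z)
      \<le> 4 * (s\<^sup>2 * (\<Sum>i\<in>{1..k * l}. \<Sum>j\<in>{k * l + 1..k * l + l}. covariance M (X i) (X j)))"
    unfolding split by (auto simp: S_def[abs_def])
  also have "\<dots> \<le> 4 * (s\<^sup>2 * R l)"
    by (intro mult_left_mono covariance_blocks_le) auto
  finally have 1: "norm (cf (S \<phi> (Suc k * l)) s - cf (S \<phi> (k * l)) s * ?z) \<le> 4 * (s\<^sup>2 * R l)" .
  have "norm (cf (S \<phi> (k * l)) s * ?z - ?z ^ Suc k) = norm (cf (S \<phi> (k * l)) s - ?z ^ k) * norm ?z"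
    by (simp only: norm_mult[symmetric]) (simp add: algebra_simps)
  also have "\<dots> \<le> real k * (4 * (s\<^sup>2 * R l)) * 1"
    by (intro mult_mono Suc z order_trans[OF norm_ge_zero Suc]) auto
  finally have "norm (cf (S \<phi> (Suc k * l)) s - ?z ^ Suc k)
      \<le> 4 * (s\<^sup>2 * R l) + real k * (4 * (s\<^sup>2 * R l)) * 1"
    by (rule norm_diff_triangle_le[OF 1])
  also have "\<dots> = real (Suc k) * (4 * (s\<^sup>2 * R l))"
    by (simp add: distrib_right)
  finally show ?case .
qed

text \<open>Adding observation n + 1 raises the variance by \<open>d 0\<close> plus twice a partial
  sum of the series of \<open>d (Suc j)\<close>. These increments converge because |d| is dominated
  by \<open>c\<close>, and their averages have the same limit.\<close>

lemma variance_S_tendsto: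
  assumes lip: "\<And>x y. \<bar>\<phi> x - \<phi> y\<bar> \<le> \<bar>x - y :: real\<bar>"
  defines "d \<equiv> \<lambda>j. covariance M (\<lambda>\<omega>. \<phi> (X 1 \<omega>)) (\<lambda>\<omega>. \<phi> (X (Suc j) \<omega>))"
  shows "(\<lambda>n. covariance M (S \<phi> n) (S \<phi> n) / real n) \<longlonglongrightarrow> d 0 + 2 * (\<Sum>j. d (Suc j))"
proof -
  have eb: "ess_bounded (\<lambda>\<omega>. \<phi> (X n \<omega>))" if "n \<ge> 1" for n
    using lipschitz_ess_bounded[OF lip that] .
  note ebS = S_ess_bounded[OF lip]
  have m: "\<phi> \<in> borel_measurable borel" by (rule lipschitz_measurable[OF lip])
  have "summable d"
    using lipschitz_covariance_le[OF lip] unfolding d_def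
    by (intro summable_comparison_test[OF _ summable_c]) auto
  then have sd: "summable (\<lambda>j. d (Suc j))" by (simp add: summable_Suc_iff)
  have S_Suc: "S \<phi> (Suc n) = (\<lambda>\<omega>. S \<phi> n \<omega> + \<phi> (X (Suc n) \<omega>))" for n
    by (simp add: S_def[abs_def])
  have cross: "covariance M (S \<phi> n) (\<lambda>\<omega>. \<phi> (X (Suc n) \<omega>)) = (\<Sum>j<n. d (Suc j))" for n
  proof -
    have "covariance M (S \<phi> n) (\<lambda>\<omega>. \<phi> (X (Suc n) \<omega>))
        = (\<Sum>i\<in>{1..n}. covariance M (\<lambda>\<omega>. \<phi> (X i \<omega>)) (\<lambda>\<omega>. \<phi> (X (Suc n) \<omega>)))"
      unfolding S_def[abs_def] by (intro covariance_sum_left eb) auto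
    also have "\<dots> = (\<Sum>i\<in>{1..n}. d (Suc n - i))"
      unfolding d_def by (intro sum.cong refl covariance_lag m) auto
    also have "\<dots> = (\<Sum>j<n. d (Suc j))"
      by (rule sum.reindex_bij_witness[of _ "\<lambda>n'. n - n'" "\<lambda>i. n - i"]) (auto simp: Suc_diff_le)
    finally show ?thesis .
  qed
  have diag: "covariance M (\<lambda>\<omega>. \<phi> (X (Suc n) \<omega>)) (\<lambda>\<omega>. \<phi> (X (Suc n) \<omega>)) = d 0" for n
    using covariance_lag[OF m m, of "Suc n" "Suc n"] by (simp add: d_def)
  have "covariance M (S \<phi> n) (S \<phi> n) = (\<Sum>k<n. d 0 + 2 * (\<Sum>j<k. d (Suc j)))" for n
  proof (induction n)
    case 0
    have "S \<phi> 0 = (\<lambda>_. 0)" by (auto simp: S_def)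
    then show ?case by simp
  next
    case (Suc n)
    have "covariance M (S \<phi> (Suc n)) (S \<phi> (Suc n))
        = covariance M (S \<phi> n) (S \<phi> n) + (d 0 + 2 * (\<Sum>j<n. d (Suc j)))"
      unfolding S_Suc
      by (simp add: covariance_add_left covariance_add_right ebS eb ess_bounded_add diag cross
          covariance_commute[of "\<lambda>\<omega>. \<phi> (X (Suc n) \<omega>)" "S \<phi> n"])
    with Suc show ?case by simp
  qed
  moreover have "(\<lambda>k. d 0 + 2 * (\<Sum>j<k. d (Suc j))) \<longlonglongrightarrow> d 0 + 2 * (\<Sum>j. d (Suc j))"
    by (intro tendsto_intros summable_LIMSEQ sd)
  ultimately show ?thesis by (simp only: Cesaro_mean_tendsto)
qed

end

section \<open>Central limit theorem for Lipschitz functions of an associated sequence\<close>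

text \<open>With p the quadratic Taylor minorant of exp x and q the claimed majorant of exp(-x), the
  product p q equals 1 + x^4/4, hence exp(-x) \<le> 1/p \<le> q. The other side is the tangent-line
  bound.\<close>

lemma exp_minus_quadratic_bound:
  fixes x :: real assumes "x \<ge> 0"
  shows "\<bar>exp (- x) - (1 - x)\<bar> \<le> x\<^sup>2 / 2"
proof -
  let ?q = "1 - x + x\<^sup>2 / 2" and ?p = "1 + x + x\<^sup>2 / 2"
  have p: "?p > 0" using assms by (simp add: add_pos_nonneg)
  have "?p * ?q = 1 + x ^ 4 / 4" by (simp add: field_simps power2_eq_square power4_eq_xxxx)
  moreover have "x ^ 4 / 4 \<ge> 0" by simp
  ultimately have "1 \<le> ?p * ?q" by linarith
  then have "1 / ?p \<le> ?q" using p by (simp add: pos_divide_le_eq mult.commute)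
  moreover have "exp (- x) \<le> 1 / ?p"
    unfolding exp_minus inverse_eq_divide
    using p exp_lower_Taylor_quadratic[OF assms] by (intro frac_le) auto
  moreover have "1 - x \<le> exp (- x)" using exp_ge_add_one_self[of "- x"] by simp
  ultimately show ?thesis by (simp add: abs_le_iff)
qed

lemma div_over_tendsto:
  assumes "l > 0"
  shows "(\<lambda>n. real (n div l) / real n) \<longlonglongrightarrow> 1 / real l"
proof (rule tendsto_sandwich)
  have "1 / real l - 1 / real n \<le> real (n div l) / real n \<and> real (n div l) / real n \<le> 1 / real l"
    if "n > 0" for n
  proof -
    have "real n = real (n div l) * real l + real (n mod l)"
      by (metis div_mult_mod_eq of_nat_add of_nat_mult)
    moreover have "real (n mod l) < real l" "0 \<le> real (n mod l)" using assms by auto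
    ultimately have "real (n div l) * real l \<le> real n" "real n \<le> real (n div l) * real l + real l"
      by linarith+
    with assms that mult_left_mono[of "real n" "real (n div l) * real l + real l" "real n"]
    show ?thesis by (simp add: field_simps)
  qed
  then show "\<forall>\<^sub>F n in sequentially. 1 / real l - 1 / real n \<le> real (n div l) / real n"
    "\<forall>\<^sub>F n in sequentially. real (n div l) / real n \<le> 1 / real l"
    by (auto intro: eventually_sequentiallyI[of 1])
  show "(\<lambda>n. 1 / real l - 1 / real n) \<longlonglongrightarrow> 1 / real l"
    using tendsto_diff[OF tendsto_const lim_1_over_n, of "1 / real l"] by simp
qed simp

context summable_assoc_sequence
begin

lemma S_sum_bound:
  assumes lip: "\<And>x y. \<bar>\<phi> x - \<phi> y\<bar> \<le> \<bar>x - y :: real\<bar>" and A: "finite A" "A \<subseteq> {1..}"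
  shows "AE \<omega> in M. \<bar>\<Sum>i\<in>A. \<phi> (X i \<omega>)\<bar> \<le> real (card A) * (\<bar>\<phi> 0\<bar> + C)"
proof -
  have "AE \<omega> in M. \<forall>i\<in>A. \<bar>\<phi> (X i \<omega>)\<bar> \<le> \<bar>\<phi> 0\<bar> + C"
    using A by (intro AE_finite_allI lipschitz_bound lip) auto
  then show ?thesis
  proof eventually_elim
    case (elim \<omega>)
    have "\<bar>\<Sum>i\<in>A. \<phi> (X i \<omega>)\<bar> \<le> (\<Sum>i\<in>A. \<bar>\<phi> (X i \<omega>)\<bar>)" by (rule sum_abs)
    also have "\<dots> \<le> real (card A) * (\<bar>\<phi> 0\<bar> + C)" using elim by (intro sum_bounded_above) auto
    finally show ?case .
  qed
qed

lemma S_bound: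
  assumes lip: "\<And>x y. \<bar>\<phi> x - \<phi> y\<bar> \<le> \<bar>x - y :: real\<bar>"
  shows "AE \<omega> in M. \<bar>S \<phi> n \<omega>\<bar> \<le> real n * (\<bar>\<phi> 0\<bar> + C)"
  using S_sum_bound[OF lip, of "{1..n}"] by (auto simp: S_def)

lemma C_nonneg: "C \<ge> 0"
proof -
  have "AE \<omega> in M. 0 \<le> C" using X_bound[OF order_refl] by eventually_elim auto
  then show ?thesis by simp
qed

text \<open>Three errors in turn: the incomplete last block has fewer than \<open>l\<close> terms
  and is dropped in L1; the full blocks are decoupled by Newman's inequality; each block factor is
  replaced by a Gaussian one through Taylor expansion. The bound holds for all \<open>n\<close>,
  \<open>l\<close> and \<open>s\<close>, so the order of limits can be chosen afterwards.\<close>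

lemma cf_S_block_approx:
  fixes \<phi> s l n
  assumes lip: "\<And>x y. \<bar>\<phi> x - \<phi> y\<bar> \<le> \<bar>x - y :: real\<bar>"
    and zero: "expectation (\<lambda>\<omega>. \<phi> (X 1 \<omega>)) = 0" and l: "l > 0"
  defines "D \<equiv> \<bar>\<phi> 0\<bar> + C" and "V \<equiv> covariance M (S \<phi> l) (S \<phi> l)"
  shows "norm (cf (S \<phi> n) s - of_real (exp (- (s\<^sup>2 * V / 2)) ^ (n div l)))
       \<le> \<bar>s\<bar> * (real l * D) + real n / real l * (4 * (s\<^sup>2 * R l))
         + real n * (\<bar>s\<bar>^3 * (real l * D)^3 / 6 + (s\<^sup>2 * V / 2)\<^sup>2 / 2)"
proof -
  define k where "k = n div l"
  have D: "D \<ge> 0" unfolding D_def using C_nonneg by simp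
  have V: "V \<ge> 0" unfolding V_def covariance_def by simp
  note ebS = S_ess_bounded[OF lip]
  have mS: "S \<phi> m \<in> borel_measurable M" for m by (rule ess_bounded_measurable[OF ebS])
  have m: "\<phi> \<in> borel_measurable borel" by (rule lipschitz_measurable[OF lip])
  have kl: "k * l \<le> n" "n - k * l < l"
    using l unfolding k_def by (auto simp: minus_div_mult_eq_mod)
  \<comment> \<open>The sharp bound on \<open>k\<close> is kept for the Newman term, where the
    division produces \<open>R l / l\<close>. The coarser \<open>k \<le> n\<close> below is enough
    for the Taylor term, where \<open>l\<close> stays fixed while \<open>n\<close> grows.\<close>
  have kn: "real k \<le> real n / real l"
    using kl(1) l of_nat_mono[OF kl(1), where ?'a = real] by (simp add: pos_le_divide_eq)
  have "real n / real l \<le> real n" using l mult_right_mono[of 1 "real l" "real n"] by (simp add: field_simps)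
  with kn have kn': "real k \<le> real n" by simp
  have diff: "S \<phi> n \<omega> - S \<phi> (k * l) \<omega> = (\<Sum>i\<in>{k * l + 1..n}. \<phi> (X i \<omega>))" for \<omega>
    using sum.ub_add_nat[of 1 "k * l" "\<lambda>i. \<phi> (X i \<omega>)" "n - k * l"] kl by (simp add: S_def)
  have ABS: "AE \<omega> in M. \<bar>S \<phi> n \<omega> - S \<phi> (k * l) \<omega>\<bar> \<le> real l * D"
    using S_sum_bound[OF lip, of "{k * l + 1..n}", folded D_def] unfolding diff
  proof (rule AE_mp[OF _ AE_I2], safe)
    fix \<omega> assume "\<bar>\<Sum>i\<in>{k * l + 1..n}. \<phi> (X i \<omega>)\<bar> \<le> real (card {k * l + 1..n}) * D"
    also have "\<dots> \<le> real l * D" using kl D by (intro mult_right_mono of_nat_mono) simp_all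
    finally show "\<bar>\<Sum>i\<in>{k * l + 1..n}. \<phi> (X i \<omega>)\<bar> \<le> real l * D" .
  qed auto
  have "expectation (\<lambda>\<omega>. \<bar>S \<phi> n \<omega> - S \<phi> (k * l) \<omega>\<bar>) \<le> expectation (\<lambda>\<omega>. real l * D)"
    by (intro integral_mono_AE ABS integrable_abs ess_bounded_integrable ess_bounded_diff ebS) simp
  then have "expectation (\<lambda>\<omega>. \<bar>S \<phi> n \<omega> - S \<phi> (k * l) \<omega>\<bar>) \<le> real l * D"
    by (simp add: prob_space)
  then have "norm (cf (S \<phi> n) s - cf (S \<phi> (k * l)) s) \<le> \<bar>s\<bar> * (real l * D)"
    by (intro order_trans[OF cf_diff_le[OF ebS ebS] mult_left_mono]) simp_all
  moreover have "norm (cf (S \<phi> (k * l)) s - cf (S \<phi> l) s ^ k) \<le> real n / real l * (4 * (s\<^sup>2 * R l))"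
  proof -
    have "R l \<ge> 0"
      unfolding R_def by (intro sum_nonneg suminf_nonneg summable_ignore_initial_segment summable_c c_nonneg)
    then have "real k * (4 * (s\<^sup>2 * R l)) \<le> real n / real l * (4 * (s\<^sup>2 * R l))"
      by (intro mult_right_mono kn) simp
    with cf_S_power[OF lip] show ?thesis by (rule order_trans)
  qed
  moreover have "norm (cf (S \<phi> l) s ^ k - of_real (exp (- (s\<^sup>2 * V / 2))) ^ k)
      \<le> real n * (\<bar>s\<bar>^3 * (real l * D)^3 / 6 + (s\<^sup>2 * V / 2)\<^sup>2 / 2)"
  proof -
    have "expectation (\<lambda>\<omega>. \<phi> (X i \<omega>)) = 0" if "i \<ge> 1" for i
      using expectation_marginal[OF m that] zero by simp
    then have "expectation (S \<phi> l) = 0"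
      unfolding S_def[abs_def]
      by (subst Bochner_Integration.integral_sum)
         (auto intro!: ess_bounded_integrable lipschitz_ess_bounded lip)
    from cf_taylor[OF mS S_bound[OF lip, folded D_def] this, of s]
    have 1: "norm (cf (S \<phi> l) s - of_real (1 - s\<^sup>2 * V / 2)) \<le> \<bar>s\<bar>^3 * (real l * D)^3 / 6"
      by (simp add: V_def)
    have "norm (of_real (1 - s\<^sup>2 * V / 2) - of_real (exp (- (s\<^sup>2 * V / 2))) :: complex)
        = \<bar>exp (- (s\<^sup>2 * V / 2)) - (1 - s\<^sup>2 * V / 2)\<bar>"
      by (simp only: of_real_diff[symmetric] norm_of_real abs_minus_commute)
    also have "\<dots> \<le> (s\<^sup>2 * V / 2)\<^sup>2 / 2"
      using V by (intro exp_minus_quadratic_bound) simp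
    finally have 2: "norm (cf (S \<phi> l) s - of_real (exp (- (s\<^sup>2 * V / 2))))
        \<le> \<bar>s\<bar>^3 * (real l * D)^3 / 6 + (s\<^sup>2 * V / 2)\<^sup>2 / 2"
      by (rule norm_diff_triangle_le[OF 1])
    \<comment> \<open>In the unit disc k-th powers differ by at most \<open>k\<close> times the
      difference of the bases; \<open>V \<ge> 0\<close> puts the Gaussian factor into the
      disc.\<close>
    have "norm (cf (S \<phi> l) s ^ k - of_real (exp (- (s\<^sup>2 * V / 2))) ^ k)
       \<le> real k * norm (cf (S \<phi> l) s - of_real (exp (- (s\<^sup>2 * V / 2))))"
      using V by (intro norm_power_diff norm_cf_le_1 mS) (simp add: norm_of_real)
    also have "\<dots> \<le> real n * (\<bar>s\<bar>^3 * (real l * D)^3 / 6 + (s\<^sup>2 * V / 2)\<^sup>2 / 2)"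
      by (intro mult_mono 2 kn') auto
    finally show ?thesis .
  qed
  ultimately have "norm (cf (S \<phi> n) s - of_real (exp (- (s\<^sup>2 * V / 2))) ^ k)
     \<le> \<bar>s\<bar> * (real l * D) + real n / real l * (4 * (s\<^sup>2 * R l))
         + real n * (\<bar>s\<bar>^3 * (real l * D)^3 / 6 + (s\<^sup>2 * V / 2)\<^sup>2 / 2)"
    by (blast intro: norm_diff_triangle_le)
  then show ?thesis by (simp add: k_def of_real_power)
qed

text \<open>The block length is fixed first, long enough to make the Newman error and the error in
  the normalised block variance small; only then does \<open>n\<close> tend to infinity.\<close>

lemma cf_S_tendsto:
  assumes lip: "\<And>x y. \<bar>\<phi> x - \<phi> y\<bar> \<le> \<bar>x - y :: real\<bar>"
    and zero: "expectation (\<lambda>\<omega>. \<phi> (X 1 \<omega>)) = 0"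
    and lim: "(\<lambda>n. covariance M (S \<phi> n) (S \<phi> n) / real n) \<longlonglongrightarrow> \<sigma>2"
  shows "(\<lambda>n. cf (S \<phi> n) (t / sqrt (real n))) \<longlonglongrightarrow> of_real (exp (- (t\<^sup>2 * \<sigma>2 / 2)))"
proof (rule LIMSEQ_I)
  fix e :: real assume e: "e > 0"
  define V where "V = (\<lambda>l. covariance M (S \<phi> l) (S \<phi> l))"
  define D where "D = \<bar>\<phi> 0\<bar> + C"
  have "(\<lambda>l. exp (- (t\<^sup>2 * (V l / real l) / 2))) \<longlonglongrightarrow> exp (- (t\<^sup>2 * \<sigma>2 / 2))"
    using lim unfolding V_def by (intro tendsto_intros) auto
  from tendstoD[OF this, of "e / 4"] e have 1: "\<forall>\<^sub>F l in sequentially. \<bar>exp (- (t\<^sup>2 * (V l / real l) / 2)) - exp (- (t\<^sup>2 * \<sigma>2 / 2))\<bar> < e / 4"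
    unfolding dist_real_def by simp
  have "(\<lambda>l. 4 * t\<^sup>2 * (R l / real l)) \<longlonglongrightarrow> 4 * t\<^sup>2 * 0"
    by (intro tendsto_intros R_tendsto)
  from order_tendstoD(2)[OF this, of "e / 4"] e
  have 2: "\<forall>\<^sub>F l in sequentially. 4 * t\<^sup>2 * (R l / real l) < e / 4" by simp
  obtain l where l: "l > 0"
    and l1: "\<bar>exp (- (t\<^sup>2 * (V l / real l) / 2)) - exp (- (t\<^sup>2 * \<sigma>2 / 2))\<bar> < e / 4"
    and l2: "4 * t\<^sup>2 * (R l / real l) < e / 4"
    using eventually_happens'[OF sequentially_bot
        eventually_conj[OF eventually_gt_at_top[of 0] eventually_conj[OF 1 2]]]
    by blast
  let ?s = "\<lambda>n. t / sqrt (real n)"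
  \<comment> \<open>Collects the terms that vanish as \<open>n\<close> grows with \<open>l\<close>
    fixed. The Newman term is free of \<open>n\<close> and is controlled by the choice of
    \<open>l\<close>.\<close>
  define err where "err = (\<lambda>n. \<bar>t\<bar> * (real l * D) * (1 / sqrt (real n))
    + (\<bar>t\<bar>^3 * (real l * D)^3 / 6 * (1 / sqrt (real n)) + (t\<^sup>2 * V l / 2)\<^sup>2 / 2 * (1 / real n)))"
  have sq0: "(\<lambda>n. 1 / sqrt (real n)) \<longlonglongrightarrow> 0"
    using tendsto_real_sqrt[OF lim_1_over_n] by (simp add: real_sqrt_divide)
  have "err \<longlonglongrightarrow> \<bar>t\<bar> * (real l * D) * 0
    + (\<bar>t\<bar>^3 * (real l * D)^3 / 6 * 0 + (t\<^sup>2 * V l / 2)\<^sup>2 / 2 * 0)"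
    unfolding err_def by (intro tendsto_intros sq0 lim_1_over_n)
  from tendstoD[OF this, of "e / 4"] e have ev1: "\<forall>\<^sub>F n in sequentially. \<bar>err n\<bar> < e / 4"
    unfolding dist_real_def by simp
  have "(\<lambda>n. exp (- (t\<^sup>2 * V l / 2 * (real (n div l) / real n)))) \<longlonglongrightarrow> exp (- (t\<^sup>2 * V l / 2 * (1 / real l)))"
    by (intro tendsto_intros div_over_tendsto l)
  from tendstoD[OF this, of "e / 4"] e have ev2: "\<forall>\<^sub>F n in sequentially.
      \<bar>exp (- (t\<^sup>2 * V l / 2 * (real (n div l) / real n))) - exp (- (t\<^sup>2 * V l / 2 * (1 / real l)))\<bar> < e / 4"
    unfolding dist_real_def by simp
  have "\<forall>\<^sub>F n in sequentially. norm (cf (S \<phi> n) (?s n) - of_real (exp (- (t\<^sup>2 * \<sigma>2 / 2)))) < e"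
    using ev1 ev2 eventually_gt_at_top[of 0]
  proof eventually_elim
    case (elim n)
    then have n: "real n > 0" by simp
    have s2: "(?s n)\<^sup>2 = t\<^sup>2 / real n" using n by (simp add: power_divide)
    have s3: "\<bar>?s n\<bar> ^ 3 = \<bar>t\<bar> ^ 3 / (real n * sqrt (real n))"
      using n by (simp add: power_divide power3_eq_cube)
    have pw: "exp (- ((?s n)\<^sup>2 * V l / 2)) ^ (n div l) = exp (- (t\<^sup>2 * V l / 2 * (real (n div l) / real n)))"
    proof -
      have "real (n div l) * - ((?s n)\<^sup>2 * V l / 2) = - (t\<^sup>2 * V l / 2 * (real (n div l) / real n))"
        unfolding s2 by (simp add: mult_ac)
      then show ?thesis by (simp only: exp_of_nat_mult[symmetric])
    qed
    have "norm (cf (S \<phi> n) (?s n) - of_real (exp (- (t\<^sup>2 * V l / 2 * (real (n div l) / real n)))))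
       \<le> \<bar>?s n\<bar> * (real l * D) + real n / real l * (4 * ((?s n)\<^sup>2 * R l))
         + real n * (\<bar>?s n\<bar>^3 * (real l * D)^3 / 6 + ((?s n)\<^sup>2 * V l / 2)\<^sup>2 / 2)"
      unfolding pw[symmetric] unfolding V_def D_def by (rule cf_S_block_approx[OF lip zero l])
    also have "\<dots> = err n + 4 * t\<^sup>2 * (R l / real l)"
    proof -
      have "real n * (\<bar>t\<bar> ^ 3 / (real n * sqrt (real n)) * A / 6) = \<bar>t\<bar> ^ 3 * A / 6 * (1 / sqrt (real n))" for A
        using n by simp
      moreover have "real n * ((t\<^sup>2 / real n * V l / 2)\<^sup>2 / 2) = (t\<^sup>2 * V l / 2)\<^sup>2 / 2 * (1 / real n)"
        using n by (simp add: power_divide power_mult_distrib) (simp add: power2_eq_square)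
      moreover have "real n / real l * (4 * (t\<^sup>2 / real n * R l)) = 4 * t\<^sup>2 * (R l / real l)"
        using n by simp
      ultimately show ?thesis
        unfolding s2 s3 err_def by (simp only: distrib_left) simp
    qed
    also have "\<dots> < e / 4 + e / 4" using elim(1) l2 by linarith
    finally have a: "norm (cf (S \<phi> n) (?s n) - of_real (exp (- (t\<^sup>2 * V l / 2 * (real (n div l) / real n)))))
       < e / 4 + e / 4" .
    have "\<bar>exp (- (t\<^sup>2 * V l / 2 * (real (n div l) / real n))) - exp (- (t\<^sup>2 * \<sigma>2 / 2))\<bar> < e / 4 + e / 4"
    proof -
      have "t\<^sup>2 * V l / 2 * (1 / real l) = t\<^sup>2 * (V l / real l) / 2" by simp
      from elim(2)[unfolded this] l1 show ?thesis by linarith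
    qed
    then have b: "norm (of_real (exp (- (t\<^sup>2 * V l / 2 * (real (n div l) / real n)))) - of_real (exp (- (t\<^sup>2 * \<sigma>2 / 2))) :: complex)
       < e / 4 + e / 4"
      by (simp only: of_real_diff[symmetric] norm_of_real)
    from norm_diff_triangle_less[OF a b] show ?case by simp
  qed
  then show "\<exists>no. \<forall>n\<ge>no. norm (cf (S \<phi> n) (?s n) - of_real (exp (- (t\<^sup>2 * \<sigma>2 / 2)))) < e"
    by (simp add: eventually_sequentially)
qed

end

section \<open>The degenerate part of the kernel\<close>

definition ind :: "real \<Rightarrow> real \<Rightarrow> real" where
  "ind t x = (if x \<le> t then 1 else 0)"

lemma abs_ind_le [simp]: "\<bar>ind t x\<bar> \<le> 1" by (simp add: ind_def)

lemma ind_measurable [measurable (raw)]: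
  "f \<in> borel_measurable N \<Longrightarrow> g \<in> borel_measurable N \<Longrightarrow> (\<lambda>p. ind (f p) (g p)) \<in> borel_measurable N"
  unfolding ind_def by measurable

lemma abs_ind_diff: "\<bar>ind t x - ind t y\<bar> = ind t x + ind t y - 2 * (ind t x * ind t y)"
  by (simp add: ind_def)

text \<open>Continuous surrogate for \<open>ind t\<close>, falling linearly from 1 at
  \<open>t\<close> to 0 at \<open>t + e\<close>. Its slope is -1/e, so \<open>e * ramp t e\<close>
  is 1-Lipschitz and falls under the covariance bound for Lipschitz functions.\<close>

definition ramp :: "real \<Rightarrow> real \<Rightarrow> real \<Rightarrow> real" where
  "ramp t e x = max 0 (min 1 ((t + e - x) / e))"

lemma ramp_lipschitz:
  assumes "e > 0"
  shows "\<bar>e * ramp t e x - e * ramp t e y\<bar> \<le> \<bar>x - y\<bar>"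
proof -
  have "e * ramp t e z = max 0 (min e (t + e - z))" for z
    using assms by (auto simp: ramp_def max_def min_def field_simps)
  then show ?thesis by (auto simp: max_def min_def)
qed

lemma abs_ramp_le: "\<bar>ramp t e x\<bar> \<le> 1"
  by (auto simp: ramp_def)

lemma ind_minus_ramp:
  assumes "e > 0"
  shows "\<bar>ind t x - ramp t e x\<bar> \<le> indicator {t<..t + e} x"
  using assms by (auto simp: ramp_def ind_def indicator_def max_def min_def field_simps)

text \<open>The bounded density enters through \<open>concentration\<close>. The exponent 1/3 is the
  one that results from the optimal smoothing scale for indicators.\<close>

locale assoc_density_sequence = summable_assoc_sequence +
  fixes K :: real
  assumes concentration: "e > 0 \<Longrightarrow> prob {\<omega> \<in> space M. X 1 \<omega> \<in> {t<..t + e}} \<le> K * e"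
    and summable_root: "summable (\<lambda>j. c j powr (1 / 3))"
begin

lemma K_nonneg: "K \<ge> 0"
  using concentration[of 1 0] measure_nonneg[of M] by (metis mult.right_neutral order_trans zero_less_one)

lemma ind_ess_bounded: "n \<ge> 1 \<Longrightarrow> ess_bounded (\<lambda>\<omega>. ind t (X n \<omega>))"
  using X_measurable[of n] by (intro ess_boundedI[where B = 1]) auto

text \<open>The indicator is replaced by the ramp in one argument after the other. The ramps
  contribute \<open>c j / e\<^sup>2\<close> by the Lipschitz bound; each replacement costs
  \<open>2 * K * e\<close>, because ramp and indicator differ only on an interval of length
  \<open>e\<close>.\<close>

lemma ind_covariance_aux:
  assumes e: "e > 0"
  shows "\<bar>covariance M (\<lambda>\<omega>. ind t (X 1 \<omega>)) (\<lambda>\<omega>. ind t (X (Suc j) \<omega>))\<bar> \<le> c j / e\<^sup>2 + 4 * K * e"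
proof -
  have mr [measurable]: "ramp t e \<in> borel_measurable borel" unfolding ramp_def by measurable
  have mi [measurable]: "ind t \<in> borel_measurable borel" by measurable
  have ebr: "ess_bounded (\<lambda>\<omega>. ramp t e (X n \<omega>))" if "n \<ge> 1" for n
    using X_measurable[OF that] by (intro ess_boundedI[where B = 1]) (auto simp: abs_ramp_le)
  have ebd: "ess_bounded (\<lambda>\<omega>. ind t (X n \<omega>) - ramp t e (X n \<omega>))" if "n \<ge> 1" for n
    by (intro ess_bounded_diff ebr ind_ess_bounded that)
  have "e\<^sup>2 * \<bar>covariance M (\<lambda>\<omega>. ramp t e (X 1 \<omega>)) (\<lambda>\<omega>. ramp t e (X (Suc j) \<omega>))\<bar> \<le> c j"
    using lipschitz_covariance_le[of "\<lambda>x. e * ramp t e x" j] ramp_lipschitz[OF e] e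
    by (simp add: covariance_scale_left covariance_scale_right abs_mult power2_eq_square mult.assoc)
  then have 1: "\<bar>covariance M (\<lambda>\<omega>. ramp t e (X 1 \<omega>)) (\<lambda>\<omega>. ramp t e (X (Suc j) \<omega>))\<bar> \<le> c j / e\<^sup>2"
    using e by (simp add: pos_le_divide_eq mult.commute)
  have dev: "expectation (\<lambda>\<omega>. \<bar>ind t (X n \<omega>) - ramp t e (X n \<omega>)\<bar>) \<le> K * e" if "n \<ge> 1" for n
  proof -
    have [measurable]: "X 1 \<in> borel_measurable M" by (rule X_measurable) simp
    have "expectation (\<lambda>\<omega>. \<bar>ind t (X n \<omega>) - ramp t e (X n \<omega>)\<bar>)
        = expectation (\<lambda>\<omega>. \<bar>ind t (X 1 \<omega>) - ramp t e (X 1 \<omega>)\<bar>)"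
      by (rule expectation_marginal[OF _ that]) measurable
    also have "\<dots> \<le> expectation (indicator {\<omega> \<in> space M. X 1 \<omega> \<in> {t<..t + e}})"
    proof (rule integral_mono_AE)
      show "integrable M (\<lambda>\<omega>. \<bar>ind t (X 1 \<omega>) - ramp t e (X 1 \<omega>)\<bar>)"
        by (intro integrable_abs ess_bounded_integrable ebd) simp
      show "integrable M (indicator {\<omega> \<in> space M. X 1 \<omega> \<in> {t<..t + e}} :: 'a \<Rightarrow> real)"
        by (intro integrable_real_indicator) (measurable, simp add: emeasure_eq_measure)
      show "AE \<omega> in M. \<bar>ind t (X 1 \<omega>) - ramp t e (X 1 \<omega>)\<bar>
          \<le> indicator {\<omega> \<in> space M. X 1 \<omega> \<in> {t<..t + e}} \<omega>"
        using ind_minus_ramp[OF e] by (intro AE_I2) (auto simp: indicator_def split: if_splits)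
    qed
    also have "\<dots> = prob {\<omega> \<in> space M. X 1 \<omega> \<in> {t<..t + e}}"
      by (auto intro!: arg_cong[where f = prob])
    also have "\<dots> \<le> K * e" by (rule concentration[OF e])
    finally show ?thesis .
  qed
  have 2: "\<bar>covariance M (\<lambda>\<omega>. ind t (X 1 \<omega>) - ramp t e (X 1 \<omega>)) (\<lambda>\<omega>. ramp t e (X (Suc j) \<omega>))\<bar> \<le> 2 * K * e"
    using covariance_bound_left[OF ebd[of 1] ebr[of "Suc j"], of 1] dev[of 1] by (simp add: abs_ramp_le)
  have 3: "\<bar>covariance M (\<lambda>\<omega>. ind t (X 1 \<omega>)) (\<lambda>\<omega>. ind t (X (Suc j) \<omega>) - ramp t e (X (Suc j) \<omega>))\<bar> \<le> 2 * K * e"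
    using covariance_bound_left[OF ebd[of "Suc j"] ind_ess_bounded[of 1 t], of 1] dev[of "Suc j"]
    by (simp add: covariance_commute[of "\<lambda>\<omega>. ind t (X (Suc 0) \<omega>)"])
  have "covariance M (\<lambda>\<omega>. ind t (X 1 \<omega>)) (\<lambda>\<omega>. ind t (X (Suc j) \<omega>))
      = covariance M (\<lambda>\<omega>. ramp t e (X 1 \<omega>)) (\<lambda>\<omega>. ramp t e (X (Suc j) \<omega>))
      + covariance M (\<lambda>\<omega>. ind t (X 1 \<omega>) - ramp t e (X 1 \<omega>)) (\<lambda>\<omega>. ramp t e (X (Suc j) \<omega>))
      + covariance M (\<lambda>\<omega>. ind t (X 1 \<omega>)) (\<lambda>\<omega>. ind t (X (Suc j) \<omega>) - ramp t e (X (Suc j) \<omega>))"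
    by (simp add: covariance_diff_left covariance_diff_right ebr ind_ess_bounded)
  with 1 2 3 show ?thesis by linarith
qed

text \<open>The smoothing scale \<open>e\<close> that balances \<open>c j / e\<^sup>2\<close>
  against \<open>e\<close> is the cube root of \<open>c j\<close>. If \<open>c j\<close> vanishes
  this scale is not positive, and \<open>e\<close> is sent to 0 instead.\<close>

lemma ind_covariance_le:
  "\<bar>covariance M (\<lambda>\<omega>. ind t (X 1 \<omega>)) (\<lambda>\<omega>. ind t (X (Suc j) \<omega>))\<bar> \<le> (4 * K + 1) * c j powr (1 / 3)"
    (is "?H \<le> _")
proof (cases "c j = 0")
  case True
  have "?H \<le> 0"
  proof (rule field_le_epsilon)
    fix d :: real assume d: "d > 0"
    \<comment> \<open>Makes \<open>4 * K * ?e\<close> at most \<open>d\<close>; the added 1 keeps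
      the denominator positive when \<open>K\<close> is 0.\<close>
    let ?e = "d / (4 * K + 1)"
    have e: "?e > 0" using d K_nonneg by simp
    have "?H \<le> 4 * K * ?e" using ind_covariance_aux[OF e, of t j] True by simp
    also have "\<dots> \<le> d" using d K_nonneg by (simp add: field_simps)
    finally show "?H \<le> 0 + d" by simp
  qed
  then show ?thesis using True by simp
next
  case False
  let ?e = "c j powr (1 / 3)"
  have c: "c j > 0" using c_nonneg[of j] False by simp
  have "?e\<^sup>2 * ?e = c j"
    using c by (simp add: powr_powr powr_add[symmetric] flip: powr_numeral)
  then have "c j / ?e\<^sup>2 = ?e" using c by (metis nonzero_mult_div_cancel_left power_not_zero powr_gt_zero less_irrefl)
  then show ?thesis
    using ind_covariance_aux[of ?e t j] c by (simp add: distrib_right)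
qed

text \<open>Bounds every row sum of indicator covariances, uniformly in the threshold. The factor 2
  accounts for lags to the left and to the right.\<close>

definition Q :: real where
  "Q = 2 * (4 * K + 1) * (\<Sum>j. c j powr (1 / 3))"

lemma covariance_ind_sum_le:
  "covariance M (\<lambda>\<omega>. \<Sum>i\<in>{1..n}. ind t (X i \<omega>)) (\<lambda>\<omega>. \<Sum>i\<in>{1..n}. ind t (X i \<omega>)) \<le> real n * Q"
proof -
  define w where "w = (\<lambda>j. c j powr (1 / 3))"
  have w: "summable w" "\<And>j. w j \<ge> 0" using summable_root by (auto simp: w_def)
  have mi: "ind t \<in> borel_measurable borel" by measurable
  have pair: "covariance M (\<lambda>\<omega>. ind t (X i \<omega>)) (\<lambda>\<omega>. ind t (X j \<omega>)) \<le> (4 * K + 1) * w (j - i)"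
    if "1 \<le> i" "i \<le> j" for i j
    using ind_covariance_le[of t "j - i"] unfolding covariance_lag[OF mi mi that] w_def by linarith
  have row: "(\<Sum>j\<in>{1..n}. covariance M (\<lambda>\<omega>. ind t (X i \<omega>)) (\<lambda>\<omega>. ind t (X j \<omega>))) \<le> Q"
    if i: "i \<in> {1..n}" for i
  proof -
    \<comment> \<open>On either side of \<open>i\<close> distinct indices have distinct lags, so
      each half of the row is bounded by the full series.\<close>
    have tail: "(\<Sum>j\<in>A. w (g j)) \<le> suminf w" if "finite A" "inj_on g A" for g and A :: "nat set"
    proof -
      have "(\<Sum>j\<in>A. w (g j)) = sum w (g ` A)" using that by (simp add: sum.reindex)
      also have "\<dots> \<le> suminf w" using that w by (intro sum_le_suminf) auto
      finally show ?thesis .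
    qed
    have "(\<Sum>j\<in>{1..n}. covariance M (\<lambda>\<omega>. ind t (X i \<omega>)) (\<lambda>\<omega>. ind t (X j \<omega>)))
        \<le> (\<Sum>j\<in>{1..n}. (4 * K + 1) * (if j \<le> i then w (i - j) else w (j - i)))"
    proof (rule sum_mono)
      fix j assume "j \<in> {1..n}"
      then show "covariance M (\<lambda>\<omega>. ind t (X i \<omega>)) (\<lambda>\<omega>. ind t (X j \<omega>))
          \<le> (4 * K + 1) * (if j \<le> i then w (i - j) else w (j - i))"
        using pair[of i j] pair[of j i] i
        by (auto simp: covariance_commute[of "\<lambda>\<omega>. ind t (X i \<omega>)"])
    qed
    also have "\<dots> = (4 * K + 1) * ((\<Sum>j\<in>{1..n} \<inter> {j. j \<le> i}. w (i - j)) + (\<Sum>j\<in>{1..n} \<inter> - {j. j \<le> i}. w (j - i)))"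
      by (simp add: sum.If_cases flip: sum_distrib_left)
    also have "\<dots> \<le> (4 * K + 1) * (suminf w + suminf w)"
      using K_nonneg by (intro mult_left_mono add_mono tail) (auto simp: inj_on_def)
    finally show ?thesis by (simp add: Q_def w_def algebra_simps)
  qed
  have "covariance M (\<lambda>\<omega>. \<Sum>i\<in>{1..n}. ind t (X i \<omega>)) (\<lambda>\<omega>. \<Sum>i\<in>{1..n}. ind t (X i \<omega>))
     = (\<Sum>i\<in>{1..n}. \<Sum>j\<in>{1..n}. covariance M (\<lambda>\<omega>. ind t (X i \<omega>)) (\<lambda>\<omega>. ind t (X j \<omega>)))"
    by (subst covariance_sum_left) (auto intro!: sum.cong covariance_sum_right ess_bounded_sum ind_ess_bounded)
  also have "\<dots> \<le> (\<Sum>i\<in>{1..n}. Q)" by (intro sum_mono row)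
  finally show ?thesis by simp
qed

section \<open>Integration over the threshold and the Hoeffding decomposition\<close>

definition L :: "real measure" where
  "L = restrict_space lborel {- C..C}"

text \<open>Finiteness is the purpose of restricting Lebesgue measure to \<open>[-C, C]\<close>:
  bounded measurable integrands become integrable and Fubini applies against
  \<open>M\<close>.\<close>

lemma finite_measure_L: "finite_measure L"
  unfolding L_def by (intro finite_measureI) 
    (simp add: emeasure_restrict_space space_restrict_space emeasure_lborel_Icc_eq)

lemma measure_space_L: "measure L (space L) = 2 * C"
  using C_nonneg unfolding L_def by (simp add: measure_restrict_space space_restrict_space)

lemma borel_measurable_L: "g \<in> borel_measurable borel \<Longrightarrow> g \<in> borel_measurable L"
  unfolding L_def by (intro measurable_restrict_space1) simp

lemma id_measurable_L [measurable]: "(\<lambda>t. t) \<in> borel_measurable L"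
  by (rule borel_measurable_L) simp

lemma integrable_L:
  fixes g :: "real \<Rightarrow> real"
  assumes "g \<in> borel_measurable L" "\<And>t. \<bar>g t\<bar> \<le> b"
  shows "integrable L g"
  using assms by (intro finite_measure.integrable_const_bound[OF finite_measure_L, where B = b]) auto

lemma Fubini_L:
  fixes g :: "real \<Rightarrow> 'a \<Rightarrow> real"
  assumes m: "case_prod g \<in> borel_measurable (L \<Otimes>\<^sub>M M)" and b: "\<And>t \<omega>. \<bar>g t \<omega>\<bar> \<le> b"
  shows "expectation (\<lambda>\<omega>. LINT t|L. g t \<omega>) = (LINT t|L. expectation (\<lambda>\<omega>. g t \<omega>))"
proof -
  interpret L: finite_measure L by (rule finite_measure_L)
  interpret pair_sigma_finite L M ..
  interpret LM: finite_measure "L \<Otimes>\<^sub>M M"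
    by (intro finite_measure_pair_measure finite_measure_L finite_measure_axioms)
  have "integrable (L \<Otimes>\<^sub>M M) (case_prod g)"
    using b by (intro LM.integrable_const_bound[OF _ m, where B = b]) auto
  from Fubini_integral[OF this] show ?thesis .
qed

lemma measurable_integral_L:
  fixes g :: "real \<Rightarrow> 'a \<Rightarrow> real"
  assumes [measurable]: "case_prod g \<in> borel_measurable (L \<Otimes>\<^sub>M M)"
  shows "(\<lambda>\<omega>. LINT t|L. g t \<omega>) \<in> borel_measurable M"
proof -
  interpret L: finite_measure L by (rule finite_measure_L)
  show ?thesis by measurable
qed

text \<open>The two indicators differ exactly for thresholds from the smaller point up to, but
  excluding, the larger one, an interval inside \<open>[-C, C]\<close>.\<close>

lemma integral_abs_ind_diff:
  assumes "\<bar>x\<bar> \<le> C" "\<bar>y\<bar> \<le> C"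
  shows "(LINT t|L. \<bar>ind t x - ind t y\<bar>) = \<bar>x - y\<bar>"
proof -
  have "indicator {- C..C} t *\<^sub>R \<bar>ind t x - ind t y\<bar> = indicator {min x y..<max x y} t" for t
    using assms by (auto simp: ind_def indicator_def min_def max_def)
  then have "(LINT t|L. \<bar>ind t x - ind t y\<bar>) = (LINT t|lborel. indicator {min x y..<max x y} t)"
    unfolding L_def by (subst integral_restrict_space) simp_all
  also have "\<dots> = \<bar>x - y\<bar>" by (simp add: min_def max_def)
  finally show ?thesis .
qed

text \<open>This is the marginal distribution function, written as an expectation.\<close>

definition G :: "real \<Rightarrow> real" where
  "G t = expectation (\<lambda>\<omega>. ind t (X 1 \<omega>))"

definition \<rho> :: "real \<Rightarrow> real" where
  "\<rho> x = expectation (\<lambda>\<omega>. \<bar>x - X 1 \<omega>\<bar>)"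

definition \<theta> :: real where
  "\<theta> = expectation (\<lambda>\<omega>. \<rho> (X 1 \<omega>))"

text \<open>With F_n the empirical distribution function, this is n^2 times the integral of (F_n -
  F)^2 over \<open>[-C, C]\<close>.\<close>

definition V :: "nat \<Rightarrow> 'a \<Rightarrow> real" where
  "V n \<omega> = (LINT t|L. (\<Sum>i\<in>{1..n}. ind t (X i \<omega>) - G t)\<^sup>2)"

lemma ind_X_measurable:
  assumes "n \<ge> 1"
  shows "(\<lambda>p. ind (fst p) (X n (snd p))) \<in> borel_measurable (L \<Otimes>\<^sub>M M)"
proof -
  note [measurable] = X_measurable[OF assms]
  have "(\<lambda>p. fst p) \<in> borel_measurable (L \<Otimes>\<^sub>M M)"
    by (rule measurable_compose[OF measurable_fst id_measurable_L])
  moreover have "(\<lambda>p. X n (snd p)) \<in> borel_measurable (L \<Otimes>\<^sub>M M)" by measurable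
  ultimately show ?thesis by (rule ind_measurable)
qed

lemma G_measurable [measurable]: "G \<in> borel_measurable L"
  unfolding G_def[abs_def] using ind_X_measurable[of 1]
  by (intro borel_measurable_lebesgue_integral) (simp add: split_beta')

lemma G_bounds: "0 \<le> G t" "G t \<le> 1"
proof -
  have "integrable M (\<lambda>\<omega>. ind t (X 1 \<omega>))" by (intro ess_bounded_integrable ind_ess_bounded) simp
  then have "G t \<le> expectation (\<lambda>\<omega>. 1)"
    unfolding G_def by (intro integral_mono) (auto simp: ind_def)
  then show "G t \<le> 1" by (simp add: prob_space)
  show "0 \<le> G t" unfolding G_def by (intro integral_nonneg_AE) (auto simp: ind_def)
qed

lemma \<rho>_lipschitz: "\<bar>\<rho> x - \<rho> y\<bar> \<le> \<bar>x - y\<bar>"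
proof -
  have i: "integrable M (\<lambda>\<omega>. \<bar>z - X 1 \<omega>\<bar>)" for z
    by (intro integrable_abs ess_bounded_integrable ess_bounded_diff X_ess_bounded) auto
  have "\<bar>\<rho> x - \<rho> y\<bar> = \<bar>expectation (\<lambda>\<omega>. \<bar>x - X 1 \<omega>\<bar> - \<bar>y - X 1 \<omega>\<bar>)\<bar>"
    unfolding \<rho>_def using i by simp
  also have "\<dots> \<le> expectation (\<lambda>\<omega>. \<bar>\<bar>x - X 1 \<omega>\<bar> - \<bar>y - X 1 \<omega>\<bar>\<bar>)" by (rule integral_abs_bound)
  also have "\<dots> \<le> expectation (\<lambda>\<omega>. \<bar>x - y\<bar>)"
    by (intro integral_mono integrable_abs Bochner_Integration.integrable_diff ess_bounded_integrable
        X_ess_bounded ess_bounded_const) auto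
  finally show ?thesis by (simp add: prob_space)
qed

lemma integrable_ind_L: "integrable L (\<lambda>t. ind t x)" "integrable L G"
  "integrable L (\<lambda>t. ind t x * G t)" "integrable L (\<lambda>t. G t * ind t x)"
  "integrable L (\<lambda>t. ind t x * ind t y)" "integrable L (\<lambda>t. G t * G t)"
  by (rule integrable_L[where b = 1]; auto simp: abs_mult G_bounds intro!: mult_le_one)+

text \<open>The threshold representation of |x - y| is averaged over \<open>y\<close> and the
  integrals are exchanged; the integrand is affine in the indicator of \<open>y\<close>, so only
  \<open>G\<close> survives.\<close>

lemma \<rho>_eq:
  assumes "\<bar>x\<bar> \<le> C"
  shows "\<rho> x = (LINT t|L. ind t x + G t - 2 * (ind t x * G t))"
proof -
  have i: "integrable M (\<lambda>\<omega>. ind t (X 1 \<omega>))" for t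
    by (intro ess_bounded_integrable ind_ess_bounded) simp
  have "\<rho> x = expectation (\<lambda>\<omega>. LINT t|L. \<bar>ind t x - ind t (X 1 \<omega>)\<bar>)"
    unfolding \<rho>_def
  proof (rule integral_cong_AE)
    show "(\<lambda>\<omega>. \<bar>x - X 1 \<omega>\<bar>) \<in> borel_measurable M" using X_measurable[of 1] by measurable
    show "(\<lambda>\<omega>. LINT t|L. \<bar>ind t x - ind t (X 1 \<omega>)\<bar>) \<in> borel_measurable M"
      using ind_X_measurable[of 1] by (intro measurable_integral_L) (simp add: split_beta')
    show "AE \<omega> in M. \<bar>x - X 1 \<omega>\<bar> = (LINT t|L. \<bar>ind t x - ind t (X 1 \<omega>)\<bar>)"
      using X_bound[OF order_refl] by eventually_elim (simp add: integral_abs_ind_diff assms)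
  qed
  also have "\<dots> = (LINT t|L. expectation (\<lambda>\<omega>. \<bar>ind t x - ind t (X 1 \<omega>)\<bar>))"
    using ind_X_measurable[of 1]
    by (intro Fubini_L[where b = 1]) (simp_all add: split_beta' ind_def)
  also have "\<dots> = (LINT t|L. ind t x + G t - 2 * (ind t x * G t))"
    unfolding abs_ind_diff G_def using i by (simp add: prob_space)
  finally show ?thesis .
qed

text \<open>Averaging \<open>\<rho>_eq\<close> once more gives the classical formula: the population
  Gini difference is the integral of 2F(1 - F).\<close>

lemma \<theta>_eq: "\<theta> = (LINT t|L. 2 * G t - 2 * (G t * G t))"
proof -
  have i: "integrable M (\<lambda>\<omega>. ind t (X 1 \<omega>))" for t
    by (intro ess_bounded_integrable ind_ess_bounded) simp
  have m: "(\<lambda>(t, \<omega>). ind t (X 1 \<omega>) + G t - 2 * (ind t (X 1 \<omega>) * G t)) \<in> borel_measurable (L \<Otimes>\<^sub>M M)"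
    using ind_X_measurable[of 1] by (simp add: split_beta')
  have "\<theta> = expectation (\<lambda>\<omega>. LINT t|L. ind t (X 1 \<omega>) + G t - 2 * (ind t (X 1 \<omega>) * G t))"
    unfolding \<theta>_def
  proof (rule integral_cong_AE)
    show "(\<lambda>\<omega>. \<rho> (X 1 \<omega>)) \<in> borel_measurable M"
      by (intro ess_bounded_measurable lipschitz_ess_bounded \<rho>_lipschitz) simp
    show "(\<lambda>\<omega>. LINT t|L. ind t (X 1 \<omega>) + G t - 2 * (ind t (X 1 \<omega>) * G t)) \<in> borel_measurable M"
      by (intro measurable_integral_L m)
    show "AE \<omega> in M. \<rho> (X 1 \<omega>) = (LINT t|L. ind t (X 1 \<omega>) + G t - 2 * (ind t (X 1 \<omega>) * G t))"
      using X_bound[OF order_refl] by eventually_elim (rule \<rho>_eq)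
  qed
  also have "\<dots> = (LINT t|L. expectation (\<lambda>\<omega>. ind t (X 1 \<omega>) + G t - 2 * (ind t (X 1 \<omega>) * G t)))"
  proof (rule Fubini_L[OF m])
    show "\<bar>ind t (X 1 \<omega>) + G t - 2 * (ind t (X 1 \<omega>) * G t)\<bar> \<le> 1" for t \<omega>
      using G_bounds[of t] by (simp add: ind_def)
  qed
  also have "\<dots> = (LINT t|L. 2 * G t - 2 * (G t * G t))"
  proof -
    have "expectation (\<lambda>\<omega>. ind t (X 1 \<omega>) + G t - 2 * (ind t (X 1 \<omega>) * G t)) = 2 * G t - 2 * (G t * G t)" for t
      using i[of t] by (simp add: prob_space G_def)
    then show ?thesis by simp
  qed
  finally show ?thesis .
qed

text \<open>Hoeffding decomposition of the kernel. All four quantities are integrals over the same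
  thresholds, so the identity reduces to algebra in \<open>ind t x\<close>, \<open>ind t y\<close>
  and \<open>G t\<close>.\<close>

lemma abs_diff_kernel:
  assumes "\<bar>x\<bar> \<le> C" "\<bar>y\<bar> \<le> C"
  shows "\<bar>x - y\<bar> = \<rho> x + \<rho> y - \<theta> - 2 * (LINT t|L. (ind t x - G t) * (ind t y - G t))"
proof -
  have "\<bar>x - y\<bar> = (LINT t|L. ind t x + ind t y - 2 * (ind t x * ind t y))"
    using integral_abs_ind_diff[OF assms] by (simp add: abs_ind_diff)
  moreover have "(LINT t|L. (ind t x - G t) * (ind t y - G t))
      = (LINT t|L. ind t x * ind t y - ind t x * G t - ind t y * G t + G t * G t)"
    by (simp add: algebra_simps)
  ultimately show ?thesis
    unfolding \<rho>_eq[OF assms(1)] \<rho>_eq[OF assms(2)] \<theta>_eq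
    by (simp add: integrable_ind_L)
qed

text \<open>Summation over the full square of indices turns the degenerate part into the perfect
  square inside \<open>V n\<close>; the diagonal may be included because the kernel vanishes
  there.\<close>

lemma sum_abs_diff_eq:
  "AE \<omega> in M. (\<Sum>i\<in>{1..n}. \<Sum>j\<in>{1..n}. \<bar>X i \<omega> - X j \<omega>\<bar>)
     = 2 * real n * S (\<lambda>x. \<rho> x - \<theta>) n \<omega> + (real n)\<^sup>2 * \<theta> - 2 * V n \<omega>"
proof -
  have "AE \<omega> in M. \<forall>i\<in>{1..n}. \<bar>X i \<omega>\<bar> \<le> C"
    by (intro AE_finite_allI X_bound) auto
  then show ?thesis
  proof eventually_elim
    case (elim \<omega>)
    let ?k = "\<lambda>i t. ind t (X i \<omega>) - G t"
    have i: "integrable L (\<lambda>t. ?k i t * ?k j t)" for i j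
      by (simp add: algebra_simps integrable_ind_L)
    have "(\<Sum>i\<in>{1..n}. \<Sum>j\<in>{1..n}. \<bar>X i \<omega> - X j \<omega>\<bar>)
        = (\<Sum>i\<in>{1..n}. \<Sum>j\<in>{1..n}. (\<rho> (X i \<omega>) - \<theta>) + (\<rho> (X j \<omega>) - \<theta>) + \<theta> - 2 * (LINT t|L. ?k i t * ?k j t))"
      using elim by (intro sum.cong refl) (simp add: abs_diff_kernel)
    also have "\<dots> = 2 * real n * S (\<lambda>x. \<rho> x - \<theta>) n \<omega> + (real n)\<^sup>2 * \<theta>
        - 2 * (\<Sum>i\<in>{1..n}. \<Sum>j\<in>{1..n}. LINT t|L. ?k i t * ?k j t)"
      by (simp add: sum.distrib sum_subtractf S_def power2_eq_square right_diff_distrib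
          flip: sum_distrib_left)
    also have "(\<Sum>i\<in>{1..n}. \<Sum>j\<in>{1..n}. LINT t|L. ?k i t * ?k j t) = V n \<omega>"
      unfolding V_def power2_eq_square sum_product using i
      by (simp add: Bochner_Integration.integral_sum Bochner_Integration.integrable_sum)
    finally show ?case .
  qed
qed

lemma V_integrand_measurable:
  "(\<lambda>(t, \<omega>). (\<Sum>i\<in>{1..n}. ind t (X i \<omega>) - G t)\<^sup>2) \<in> borel_measurable (L \<Otimes>\<^sub>M M)"
  unfolding split_beta'
  by (intro borel_measurable_power borel_measurable_sum borel_measurable_diff ind_X_measurable) auto

lemma V_integrand_bound: "\<bar>(\<Sum>i\<in>{1..n}. ind t (X i \<omega>) - G t)\<^sup>2\<bar> \<le> (real n)\<^sup>2"
proof -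
  have "\<bar>\<Sum>i\<in>{1..n}. ind t (X i \<omega>) - G t\<bar> \<le> (\<Sum>i\<in>{1..n}. \<bar>ind t (X i \<omega>) - G t\<bar>)" by (rule sum_abs)
  also have "\<dots> \<le> real (card {1..n}) * 1"
    using G_bounds[of t] by (intro sum_bounded_above) (auto simp: ind_def)
  finally show ?thesis by (simp add: abs_le_square_iff[symmetric])
qed

lemma V_nonneg: "V n \<omega> \<ge> 0"
  unfolding V_def by (intro integral_nonneg_AE) auto

lemma V_integrable: "integrable M (V n)"
proof -
  interpret L: finite_measure L by (rule finite_measure_L)
  interpret pair_sigma_finite L M ..
  interpret LM: finite_measure "L \<Otimes>\<^sub>M M"
    by (intro finite_measure_pair_measure finite_measure_L finite_measure_axioms)
  have "integrable (L \<Otimes>\<^sub>M M) (\<lambda>(t, \<omega>). (\<Sum>i\<in>{1..n}. ind t (X i \<omega>) - G t)\<^sup>2)"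
    using V_integrand_bound
    by (intro LM.integrable_const_bound[OF _ V_integrand_measurable, where B = "(real n)\<^sup>2"]) auto
  from integrable_snd[OF this] show ?thesis by (simp add: V_def[abs_def])
qed

text \<open>After Fubini the integrand is the variance of the number of observations below the
  threshold, which is linear in \<open>n\<close> uniformly in \<open>t\<close>. Since
  \<open>V n\<close> is nonnegative, this also controls its L1 norm.\<close>

lemma expectation_V_le: "expectation (V n) \<le> real n * (2 * C * Q)"
proof -
  have EG: "expectation (\<lambda>\<omega>. ind t (X i \<omega>)) = G t" if "i \<ge> 1" for i t
    unfolding G_def by (rule expectation_marginal[OF _ that]) measurable
  have le: "expectation (\<lambda>\<omega>. (\<Sum>i\<in>{1..n}. ind t (X i \<omega>) - G t)\<^sup>2) \<le> real n * Q" for t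
  proof -
    have "expectation (\<lambda>\<omega>. \<Sum>i\<in>{1..n}. ind t (X i \<omega>)) = real n * G t"
      by (subst Bochner_Integration.integral_sum) (auto intro!: ess_bounded_integrable ind_ess_bounded simp: EG)
    then have "expectation (\<lambda>\<omega>. (\<Sum>i\<in>{1..n}. ind t (X i \<omega>) - G t)\<^sup>2)
        = covariance M (\<lambda>\<omega>. \<Sum>i\<in>{1..n}. ind t (X i \<omega>)) (\<lambda>\<omega>. \<Sum>i\<in>{1..n}. ind t (X i \<omega>))"
      unfolding covariance_def by (simp add: sum_subtractf power2_eq_square)
    also have "\<dots> \<le> real n * Q" by (rule covariance_ind_sum_le)
    finally show ?thesis .
  qed
  have "expectation (V n) = (LINT t|L. expectation (\<lambda>\<omega>. (\<Sum>i\<in>{1..n}. ind t (X i \<omega>) - G t)\<^sup>2))"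
    unfolding V_def[abs_def] by (rule Fubini_L[OF V_integrand_measurable V_integrand_bound])
  also have "\<dots> \<le> (LINT t|L. real n * Q)"
  proof (intro integral_mono le integrable_L[where b = "real n * Q"])
    show "(\<lambda>t. expectation (\<lambda>\<omega>. (\<Sum>i\<in>{1..n}. ind t (X i \<omega>) - G t)\<^sup>2)) \<in> borel_measurable L"
      by (rule borel_measurable_lebesgue_integral[OF V_integrand_measurable])
    show "\<bar>expectation (\<lambda>\<omega>. (\<Sum>i\<in>{1..n}. ind t (X i \<omega>) - G t)\<^sup>2)\<bar> \<le> real n * Q" for t
      using le[of t] by (simp add: integral_nonneg_AE)
    \<comment> \<open>The sign of the constant bound is read off from a variance at one
      threshold.\<close>
    have "0 \<le> expectation (\<lambda>\<omega>. (\<Sum>i\<in>{1..n}. ind 0 (X i \<omega>) - G 0)\<^sup>2)"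
      by (simp add: integral_nonneg_AE)
    then show "\<bar>real n * Q\<bar> \<le> real n * Q" using le[of 0] by linarith
  qed auto
  also have "\<dots> = real n * (2 * C * Q)" by (simp add: measure_space_L)
  finally show ?thesis .
qed

end

section \<open>Gini's mean difference\<close>

lemma sum_pairs_symmetric:
  fixes f :: "nat \<Rightarrow> nat \<Rightarrow> real"
  assumes sym: "\<And>i j. f i j = f j i" and diag: "\<And>i. f i i = 0"
  shows "(\<Sum>i\<in>{1..n}. \<Sum>j\<in>{1..n}. f i j) = 2 * (\<Sum>(i, j)\<in>{(i, j). 1 \<le> i \<and> i < j \<and> j \<le> n}. f i j)"
proof -
  let ?P = "{(i, j). 1 \<le> i \<and> i < j \<and> j \<le> n}" and ?P' = "{(i, j). 1 \<le> j \<and> j < i \<and> i \<le> n}"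
    and ?D = "(\<lambda>i. (i, i)) ` {1..n}"
  have fin: "finite ?P" "finite ?P'"
    by (rule finite_subset[of _ "{1..n} \<times> {1..n}"]; auto)+
  have "(\<Sum>i\<in>{1..n}. \<Sum>j\<in>{1..n}. f i j) = (\<Sum>(i, j)\<in>{1..n} \<times> {1..n}. f i j)"
    by (rule sum.cartesian_product)
  also have "{1..n} \<times> {1..n} = (?P \<union> ?P') \<union> ?D" by auto
  also have "(\<Sum>(i, j)\<in>(?P \<union> ?P') \<union> ?D. f i j)
      = (\<Sum>(i, j)\<in>?P. f i j) + (\<Sum>(i, j)\<in>?P'. f i j) + (\<Sum>(i, j)\<in>?D. f i j)"
    using fin by (subst sum.union_disjoint; auto intro!: sum.union_disjoint)+
  also have "(\<Sum>(i, j)\<in>?D. f i j) = 0" by (intro sum.neutral) (auto simp: diag)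
  also have "(\<Sum>(i, j)\<in>?P'. f i j) = (\<Sum>(i, j)\<in>?P. f i j)"
    by (rule sum.reindex_bij_witness[of _ prod.swap prod.swap]) (auto simp: sym)
  finally show ?thesis by simp
qed

text \<open>The terms of a convergent series are eventually below 1, hence so are the
  \<open>w j\<close>, and then a larger exponent only decreases the powers.\<close>

lemma summable_powr_exponent_mono:
  fixes w :: "nat \<Rightarrow> real"
  assumes w: "\<And>j. w j \<ge> 0" and "0 < p" "p \<le> q" and sum: "summable (\<lambda>j. w j powr p)"
  shows "summable (\<lambda>j. w j powr q)"
proof (rule summable_comparison_test_ev[OF _ sum])
  have "\<forall>\<^sub>F j in sequentially. w j powr p < 1"
    using order_tendstoD(2)[OF summable_LIMSEQ_zero[OF sum], of 1] by simp
  then show "\<forall>\<^sub>F j in sequentially. norm (w j powr q) \<le> w j powr p"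
  proof eventually_elim
    case (elim j)
    have "w j < 1"
    proof (rule ccontr)
      assume "\<not> w j < 1"
      with \<open>0 < p\<close> have "1 \<le> w j powr p" by (intro ge_one_powr_ge_zero) auto
      with elim show False by simp
    qed
    then show ?case using w[of j] assms(3) by (simp add: powr_mono')
  qed
qed

context assoc_density_sequence
begin

abbreviation \<phi> :: "real \<Rightarrow> real" where
  "\<phi> x \<equiv> \<rho> x - \<theta>"

lemma \<phi>_lipschitz: "\<bar>\<phi> x - \<phi> y\<bar> \<le> \<bar>x - y\<bar>"
  using \<rho>_lipschitz[of x y] by simp

lemma \<phi>_zero: "expectation (\<lambda>\<omega>. \<phi> (X 1 \<omega>)) = 0"
proof -
  have "integrable M (\<lambda>\<omega>. \<rho> (X 1 \<omega>))"
    by (intro ess_bounded_integrable lipschitz_ess_bounded \<rho>_lipschitz) simp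
  then show ?thesis by (simp add: \<theta>_def prob_space)
qed

lemma \<phi>_covariance:
  assumes "i \<ge> 1" "j \<ge> 1"
  shows "covariance M (\<lambda>\<omega>. \<phi> (X i \<omega>)) (\<lambda>\<omega>. \<phi> (X j \<omega>)) = covariance M (\<lambda>\<omega>. \<rho> (X i \<omega>)) (\<lambda>\<omega>. \<rho> (X j \<omega>))"
  using lipschitz_ess_bounded[OF \<rho>_lipschitz assms(1)] lipschitz_ess_bounded[OF \<rho>_lipschitz assms(2)]
  by (simp add: covariance_diff_left covariance_diff_right ess_bounded_diff)

text \<open>The full square carries \<open>n\<^sup>2\<close> copies of \<open>\<theta>\<close> while
  the statistic is normalised by n(n - 1); the surplus is the deterministic term
  \<open>\<theta> / (n - 1)\<close>.\<close>

lemma gini_decomposition: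
  assumes "n \<ge> 2"
  shows "AE \<omega> in M. gini_mean_difference X n \<omega> - \<theta>
    = 2 / (real n - 1) * S \<phi> n \<omega> + \<theta> / (real n - 1) - 2 * V n \<omega> / (real n * (real n - 1))"
  using sum_abs_diff_eq[of n]
proof eventually_elim
  case (elim \<omega>)
  have n: "real n > 0" "real n - 1 > 0" using assms by auto
  have "2 * (\<Sum>(i, j)\<in>{(i, j). 1 \<le> i \<and> i < j \<and> j \<le> n}. \<bar>X i \<omega> - X j \<omega>\<bar>)
      = 2 * real n * S \<phi> n \<omega> + (real n)\<^sup>2 * \<theta> - 2 * V n \<omega>"
    unfolding elim[symmetric] by (rule sum_pairs_symmetric[symmetric]) auto
  then have "gini_mean_difference X n \<omega>
      = (2 * real n * S \<phi> n \<omega> + (real n)\<^sup>2 * \<theta> - 2 * V n \<omega>) / (real n * (real n - 1))"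
    unfolding gini_mean_difference_def by simp
  also have "\<dots> = 2 / (real n - 1) * S \<phi> n \<omega> + real n * \<theta> / (real n - 1)
      - 2 * V n \<omega> / (real n * (real n - 1))"
    using n by (simp add: diff_divide_distrib add_divide_distrib power2_eq_square)
  also have "real n * \<theta> / (real n - 1) = \<theta> + \<theta> / (real n - 1)"
    using n by (simp add: field_simps)
  finally show ?case by simp
qed

lemma gini_ess_bounded: "ess_bounded (gini_mean_difference X n)"
  unfolding gini_mean_difference_def[abs_def] split_beta
proof (intro ess_bounded_mult ess_bounded_sum ess_bounded_const)
  fix p assume "p \<in> {p. 1 \<le> fst p \<and> fst p < snd p \<and> snd p \<le> n}"
  then have p: "1 \<le> fst p" "1 \<le> snd p" by auto
  have "AE \<omega> in M. \<bar>\<bar>X (fst p) \<omega> - X (snd p) \<omega>\<bar>\<bar> \<le> 2 * C"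
    using X_bound[OF p(1)] X_bound[OF p(2)] by eventually_elim auto
  then show "ess_bounded (\<lambda>\<omega>. \<bar>X (fst p) \<omega> - X (snd p) \<omega>\<bar>)"
    using X_measurable[OF p(1)] X_measurable[OF p(2)] 
    by (intro ess_boundedI borel_measurable_abs borel_measurable_diff)
qed

text \<open>Besides the degenerate part, what separates the statistic from its linear part is the
  deterministic surplus and the mismatch between n - 1 and n, which leaves a bounded multiple of
  \<open>S \<phi> n / n\<close>. All of this is of order n^(-1/2) in L1.\<close>

lemma gini_projection_L1:
  assumes n: "n \<ge> 2" and \<sigma>: "\<sigma> > 0"
  shows "expectation (\<lambda>\<omega>. \<bar>sqrt (real n) * (gini_mean_difference X n \<omega> - \<theta>) / (2 * \<sigma>)
      - 1 / \<sigma> / sqrt (real n) * S \<phi> n \<omega>\<bar>)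
    \<le> 2 / sqrt (real n) * ((\<bar>\<phi> 0\<bar> + C + \<bar>\<theta>\<bar> + 2 * C * Q) / \<sigma>)"
proof -
  \<comment> \<open>Common factor of all error terms, at most 2/(\<sigma> sqrt n) because n \<le>
    2(n - 1).\<close>
  let ?r = "sqrt (real n) / ((real n - 1) * \<sigma>)"
  let ?W = "\<lambda>\<omega>. sqrt (real n) * (gini_mean_difference X n \<omega> - \<theta>) / (2 * \<sigma>)
      - 1 / \<sigma> / sqrt (real n) * S \<phi> n \<omega>"
  have n': "real n > 0" "real n - 1 > 0" using n by auto
  have r: "?r > 0" using n' \<sigma> by simp
  have sq: "sqrt (real n) * sqrt (real n) = real n" by simp
  have "AE \<omega> in M. \<bar>?W \<omega>\<bar> \<le> ?r * (\<bar>\<phi> 0\<bar> + C + \<bar>\<theta>\<bar> + V n \<omega> / real n)"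
    using gini_decomposition[OF n] S_bound[OF \<phi>_lipschitz, of n]
  proof eventually_elim
    case (elim \<omega>)
    have "1 / \<sigma> / sqrt (real n) = ?r * ((real n - 1) / real n)"
      using n' \<sigma> sq by (simp add: field_simps)
    moreover have "sqrt (real n) * (gini_mean_difference X n \<omega> - \<theta>) / (2 * \<sigma>)
        = ?r * (S \<phi> n \<omega> + \<theta> / 2 - V n \<omega> / real n)"
    proof -
      have "q * (2 / m * s + th / m - 2 * v / (N * m)) / (2 * \<sigma>) = q / (m * \<sigma>) * (s + th / 2 - v / N)"
        if "m > 0" "N > 0" for q m s th v N
        using that \<sigma> by (simp add: field_simps)
      from this[OF n'(2,1)] show ?thesis unfolding elim(1) .
    qed
    ultimately have "?W \<omega> = ?r * (S \<phi> n \<omega> + \<theta> / 2 - V n \<omega> / real n - (real n - 1) / real n * S \<phi> n \<omega>)"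
      by (simp only: right_diff_distrib mult.assoc)
    also have "\<dots> = ?r * (S \<phi> n \<omega> / real n + \<theta> / 2 - V n \<omega> / real n)"
      using n' by (simp add: field_simps)
    finally have W: "?W \<omega> = ?r * (S \<phi> n \<omega> / real n + \<theta> / 2 - V n \<omega> / real n)" .
    have "\<bar>S \<phi> n \<omega> / real n\<bar> \<le> \<bar>\<phi> 0\<bar> + C"
      using elim(2) n' by (simp add: abs_divide pos_divide_le_eq mult.commute)
    moreover have "0 \<le> V n \<omega> / real n" using V_nonneg[of n \<omega>] by simp
    ultimately have "\<bar>S \<phi> n \<omega> / real n + \<theta> / 2 - V n \<omega> / real n\<bar> \<le> \<bar>\<phi> 0\<bar> + C + \<bar>\<theta>\<bar> + V n \<omega> / real n"
      by linarith
    then show ?case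
      unfolding W abs_mult using r by (simp only: abs_of_pos mult_left_mono less_imp_le)
  qed
  then have "expectation (\<lambda>\<omega>. \<bar>?W \<omega>\<bar>) \<le> expectation (\<lambda>\<omega>. ?r * (\<bar>\<phi> 0\<bar> + C + \<bar>\<theta>\<bar> + V n \<omega> / real n))"
  proof (rule integral_mono_AE[rotated 2])
    have "ess_bounded (\<lambda>\<omega>. sqrt (real n) / (2 * \<sigma>) * (gini_mean_difference X n \<omega> - \<theta>)
        - 1 / \<sigma> / sqrt (real n) * S \<phi> n \<omega>)"
      by (intro ess_bounded_diff ess_bounded_mult ess_bounded_const gini_ess_bounded
          S_ess_bounded \<phi>_lipschitz)
    then show "integrable M (\<lambda>\<omega>. \<bar>?W \<omega>\<bar>)"
      by (intro integrable_abs ess_bounded_integrable) simp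
    show "integrable M (\<lambda>\<omega>. ?r * (\<bar>\<phi> 0\<bar> + C + \<bar>\<theta>\<bar> + V n \<omega> / real n))"
      using V_integrable[of n] by (intro integrable_mult_right Bochner_Integration.integrable_add) auto
  qed
  also have "\<dots> = ?r * (\<bar>\<phi> 0\<bar> + C + \<bar>\<theta>\<bar> + expectation (V n) / real n)"
    using V_integrable[of n] by (simp add: prob_space)
  also have "\<dots> \<le> ?r * (\<bar>\<phi> 0\<bar> + C + \<bar>\<theta>\<bar> + 2 * C * Q)"
    using expectation_V_le[of n] r n'
    by (intro mult_left_mono add_left_mono) (auto simp: pos_divide_le_eq mult.commute)
  also have "\<dots> \<le> 2 / sqrt (real n) / \<sigma> * (\<bar>\<phi> 0\<bar> + C + \<bar>\<theta>\<bar> + 2 * C * Q)"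
  proof (rule mult_right_mono)
    have "sqrt (real n) / (real n - 1) \<le> 2 / sqrt (real n)"
      using n' n sq by (simp add: field_simps)
    then show "?r \<le> 2 / sqrt (real n) / \<sigma>"
      using \<sigma> by (simp add: divide_right_mono flip: divide_divide_eq_left)
    \<comment> \<open>The sign of \<open>C * Q\<close> is recovered from the nonnegative expectation
      that it bounds.\<close>
    have "0 \<le> expectation (V n)" using V_nonneg by (intro integral_nonneg_AE) auto
    with expectation_V_le[of n] have "0 \<le> real n * (2 * C * Q)" by linarith
    then have "0 \<le> 2 * C * Q" using n' by (simp add: zero_le_mult_iff)
    then show "0 \<le> \<bar>\<phi> 0\<bar> + C + \<bar>\<theta>\<bar> + 2 * C * Q" using C_nonneg by linarith
  qed
  finally show ?thesis by simp
qed

text \<open>The limit is found for the linear part and carried over to the full statistic by L1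
  closeness at the level of characteristic functions; Levy's continuity theorem concludes.\<close>

theorem gini_clt:
  assumes var: "\<sigma>2 = covariance M (\<lambda>\<omega>. \<rho> (X 1 \<omega>)) (\<lambda>\<omega>. \<rho> (X 1 \<omega>))
      + 2 * (\<Sum>j. covariance M (\<lambda>\<omega>. \<rho> (X 1 \<omega>)) (\<lambda>\<omega>. \<rho> (X (Suc (Suc j)) \<omega>)))"
    and pos: "\<sigma>2 > 0"
  shows "weak_conv_m
     (\<lambda>n. distr M borel (\<lambda>\<omega>. sqrt (real n) * (gini_mean_difference X n \<omega> - \<theta>) / (2 * sqrt \<sigma>2)))
     std_normal_distribution"
proof (rule levy_continuity)
  let ?W = "\<lambda>n \<omega>. sqrt (real n) * (gini_mean_difference X n \<omega> - \<theta>) / (2 * sqrt \<sigma>2)"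
  let ?Z = "\<lambda>n \<omega>. 1 / sqrt \<sigma>2 / sqrt (real n) * S \<phi> n \<omega>"
  have ebW: "ess_bounded (?W n)" for n
  proof -
    have "ess_bounded (\<lambda>\<omega>. sqrt (real n) / (2 * sqrt \<sigma>2) * (gini_mean_difference X n \<omega> - \<theta>))"
      by (intro ess_bounded_diff ess_bounded_mult ess_bounded_const gini_ess_bounded)
    then show ?thesis by simp
  qed
  have ebZ: "ess_bounded (?Z n)" for n
    by (intro ess_bounded_mult ess_bounded_const S_ess_bounded \<phi>_lipschitz)
  show "real_distribution (distr M borel (?W n))" for n
    using ess_bounded_measurable[OF ebW]
    by (intro real_distribution.intro real_distribution_axioms.intro prob_space_distr) auto
  show "real_distribution std_normal_distribution" by (rule real_dist_normal_dist)
  fix t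
  have "(\<lambda>n. covariance M (S \<phi> n) (S \<phi> n) / real n) \<longlonglongrightarrow> \<sigma>2"
    using variance_S_tendsto[OF \<phi>_lipschitz] unfolding var by (simp add: \<phi>_covariance)
  from cf_S_tendsto[OF \<phi>_lipschitz \<phi>_zero this, of "t / sqrt \<sigma>2"]
  have "(\<lambda>n. cf (?Z n) t) \<longlonglongrightarrow> of_real (exp (- (t\<^sup>2 / 2)))"
    using pos by (simp add: cf_def power_divide mult.assoc[symmetric])
  moreover have "(\<lambda>n. cf (?W n) t - cf (?Z n) t) \<longlonglongrightarrow> 0"
  proof (rule Lim_null_comparison)
    let ?B = "(\<bar>\<phi> 0\<bar> + C + \<bar>\<theta>\<bar> + 2 * C * Q) / sqrt \<sigma>2"
    show "\<forall>\<^sub>F n in sequentially. norm (cf (?W n) t - cf (?Z n) t) \<le> \<bar>t\<bar> * (2 * ?B) * (1 / sqrt (real n))"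
    \<comment> \<open>For n = 0 and n = 1 the normalisation n(n - 1) vanishes, so the estimate
      starts at 2.\<close>
    proof (rule eventually_sequentiallyI[of 2])
      fix n :: nat assume n: "2 \<le> n"
      have "norm (cf (?W n) t - cf (?Z n) t) \<le> \<bar>t\<bar> * expectation (\<lambda>\<omega>. \<bar>?W n \<omega> - ?Z n \<omega>\<bar>)"
        by (rule cf_diff_le[OF ebW ebZ])
      also have "\<dots> \<le> \<bar>t\<bar> * (2 / sqrt (real n) * ?B)"
        using pos by (intro mult_left_mono gini_projection_L1 n) auto
      finally show "norm (cf (?W n) t - cf (?Z n) t) \<le> \<bar>t\<bar> * (2 * ?B) * (1 / sqrt (real n))"
        by (simp add: mult_ac)
    qed
    have "(\<lambda>n. 1 / sqrt (real n)) \<longlonglongrightarrow> 0"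
      using tendsto_real_sqrt[OF lim_1_over_n] by (simp add: real_sqrt_divide)
    then show "(\<lambda>n. \<bar>t\<bar> * (2 * ?B) * (1 / sqrt (real n))) \<longlonglongrightarrow> 0"
      by (rule tendsto_mult_right_zero)
  qed
  ultimately have "(\<lambda>n. cf (?W n) t) \<longlonglongrightarrow> of_real (exp (- (t\<^sup>2 / 2)))"
    using tendsto_add[of "\<lambda>n. cf (?W n) t - cf (?Z n) t" 0 sequentially "\<lambda>n. cf (?Z n) t"] by simp
  then show "(\<lambda>n. char (distr M borel (?W n)) t) \<longlonglongrightarrow> char std_normal_distribution t"
    by (simp add: char_distr_eq_cf ess_bounded_measurable[OF ebW] char_std_normal_distribution)
qed

end

section \<open>From integrals against dF to expectations under \<open>M\<close>\<close>

lemma interval_measure_cdf: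
  assumes "real_distribution N"
  shows "interval_measure (cdf N) = N"
proof -
  interpret real_distribution N by fact
  note cdf = cdf_nondecreasing cdf_is_right_cont cdf_lim_at_bot cdf_lim_at_top_prob
  show ?thesis
    by (intro cdf_unique assms real_distribution_interval_measure cdf_interval_measure cdf)
qed

lemma distributed_prob_Ioc_le:
  assumes "prob_space M" and X: "distributed M lborel X (\<lambda>x. ennreal (f x))"
    and f: "\<And>x. f x \<le> K" and e: "e > 0" and K: "K \<ge> 0"
  shows "measure M {\<omega> \<in> space M. X \<omega> \<in> {t<..t + e}} \<le> K * e"
proof -
  interpret prob_space M by fact
  have "emeasure M (X -` {t<..t + e} \<inter> space M) = (\<integral>\<^sup>+x. ennreal (f x) * indicator {t<..t + e} x \<partial>lborel)"
    by (rule distributed_emeasure[OF X]) simp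
  also have "\<dots> \<le> (\<integral>\<^sup>+x. ennreal K * indicator {t<..t + e} x \<partial>lborel)"
    by (intro nn_integral_mono mult_right_mono ennreal_leI f) auto
  also have "\<dots> = ennreal (K * e)"
    using e K by (subst nn_integral_cmult_indicator) (simp_all add: ennreal_mult)
  finally have "emeasure M {\<omega> \<in> space M. X \<omega> \<in> {t<..t + e}} \<le> ennreal (K * e)"
    by (simp add: vimage_def Int_def conj_commute)
  then show ?thesis
    using e K by (simp add: emeasure_eq_measure)
qed

theorem theorem4p1:
  fixes M :: "'a measure"
    and X :: "nat \<Rightarrow> 'a \<Rightarrow> real"
    and F f \<rho>\<^sub>1 :: "real \<Rightarrow> real"
    and C\<^sub>1 \<gamma> \<theta> \<sigma>\<^sub>U_sq :: real
  assumes "prob_space M"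
    and "\<And>n. n \<ge> 1 \<Longrightarrow> X n \<in> borel_measurable M"
    and "strictly_stationary M X"
    and "associated M {1..} X"
    and "F = cdf (distr M borel (X 1))"
    and "distributed M lborel (X 1) (\<lambda>x. ennreal (f x))"
    and "\<And>x. 0 \<le> f x"
    and "bounded (range f)"
    and "\<And>n. n \<ge> 1 \<Longrightarrow> AE \<omega> in M. \<bar>X n \<omega>\<bar> < C\<^sub>1"
    and "0 < \<gamma>" and "\<gamma> < 1/6"
    and "summable (\<lambda>j. covariance M (X 1) (X (Suc j)) powr \<gamma>)"
    and "\<theta> = (LINT z|(interval_measure F \<Otimes>\<^sub>M interval_measure F). \<bar>fst z - snd z\<bar>)"
    and "\<And>x. \<rho>\<^sub>1 x = (LINT y|(interval_measure F). \<bar>x - y\<bar>)"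
    and "\<sigma>\<^sub>U_sq =
           prob_space.variance M (\<lambda>\<omega>. \<rho>\<^sub>1 (X 1 \<omega>)) +
           2 * (\<Sum>j. covariance M (\<lambda>\<omega>. \<rho>\<^sub>1 (X 1 \<omega>)) (\<lambda>\<omega>. \<rho>\<^sub>1 (X (1 + Suc j) \<omega>)))"
    and "\<sigma>\<^sub>U_sq > 0"
  shows "weak_conv_m
           (\<lambda>n. distr M borel
             (\<lambda>\<omega>. sqrt (real n) * (gini_mean_difference X n \<omega> - \<theta>) / (2 * sqrt \<sigma>\<^sub>U_sq)))
           std_normal_distribution"
proof -
  interpret prob_space M by fact
  have "\<exists>K. \<forall>x. \<bar>f x\<bar> \<le> K" using assms(8) by (auto simp: bounded_iff)
  then obtain K where K: "\<And>x. \<bar>f x\<bar> \<le> K" by blast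
  interpret assoc_sequence M X C\<^sub>1
  proof
    show "AE \<omega> in M. \<bar>X n \<omega>\<bar> \<le> C\<^sub>1" if "n \<ge> 1" for n
      using assms(9)[OF that] by eventually_elim simp
  qed (use assms(2-4) in auto)
  have sum: "summable (\<lambda>j. c j powr q)" if "\<gamma> \<le> q" for q
    \<comment> \<open>Used below with exponent 1 for the linear part and 1/3 for the indicator
      covariances.\<close>
    using summable_powr_exponent_mono[OF c_nonneg assms(10) that] assms(12) by (simp add: c_def)
  interpret assoc_density_sequence M X C\<^sub>1 K
  proof
    show "summable c" using sum[of 1] assms(11) c_nonneg by simp
    show "summable (\<lambda>j. c j powr (1 / 3))" using sum[of "1 / 3"] assms(11) by simp
    show "prob {\<omega> \<in> space M. X 1 \<omega> \<in> {t<..t + e}} \<le> K * e" if "e > 0" for t e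
      using K order_trans[OF abs_ge_zero K]
      by (intro distributed_prob_Ioc_le[OF assms(1,6) _ that]) (auto simp: abs_le_iff)
  qed
  define \<mu> where "\<mu> = distr M borel (X 1)"
  have X1 [measurable]: "X 1 \<in> borel_measurable M" by (rule X_measurable) simp
  have rd: "real_distribution \<mu>"
    unfolding \<mu>_def by (intro real_distribution.intro real_distribution_axioms.intro prob_space_distr X1) auto
  \<comment> \<open>The Stieltjes measure dF is the law of \<open>X 1\<close>, so integrals against
    dF pull back to expectations.\<close>
  then have \<mu>: "interval_measure F = \<mu>"
    unfolding assms(5) \<mu>_def by (rule interval_measure_cdf)
  interpret \<mu>: real_distribution \<mu> by (rule rd)
  have \<rho>: "\<rho>\<^sub>1 = \<rho>"
    unfolding assms(14)[abs_def] \<rho>_def[abs_def] \<mu> \<mu>_def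
    by (intro ext integral_distr X1) auto
  \<comment> \<open>The inner integral of the kernel is \<open>\<rho>\<close>, integrable as a
    Lipschitz function of a bounded variable. Hence the kernel is integrable for the product law and
    the double integral may be iterated.\<close>
  have \<theta>: "\<theta> = assoc_density_sequence.\<theta> M X"
  proof -
    interpret pair_sigma_finite \<mu> \<mu> ..
    have "integrable M (\<lambda>\<omega>. \<bar>x - X 1 \<omega>\<bar>)" for x
      by (intro integrable_abs ess_bounded_integrable ess_bounded_diff X_ess_bounded) auto
    then have i1: "integrable \<mu> (\<lambda>y. \<bar>x - y\<bar>)" for x
      unfolding \<mu>_def by (subst integrable_distr_eq[OF X1]) auto
    have m\<rho>: "\<rho> \<in> borel_measurable borel" by (rule lipschitz_measurable[OF \<rho>_lipschitz])
    have "integrable M (\<lambda>\<omega>. \<rho> (X 1 \<omega>))"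
      by (intro ess_bounded_integrable lipschitz_ess_bounded \<rho>_lipschitz) simp
    then have i2: "integrable \<mu> \<rho>"
      unfolding \<mu>_def using m\<rho> by (subst integrable_distr_eq[OF X1]) auto
    have \<rho>\<mu>: "(LINT y|\<mu>. \<bar>x - y\<bar>) = \<rho> x" for x
      using assms(14)[of x] \<rho> \<mu> by simp
    have "integrable (\<mu> \<Otimes>\<^sub>M \<mu>) (\<lambda>z. \<bar>fst z - snd z\<bar>)"
    proof (rule Fubini_integrable)
      have [measurable_cong]: "sets \<mu> = sets borel" by (simp add: \<mu>_def)
      show "(\<lambda>z. \<bar>fst z - snd z\<bar>) \<in> borel_measurable (\<mu> \<Otimes>\<^sub>M \<mu>)" by measurable
    qed (simp_all add: i1 i2 \<rho>\<mu>)
    from integral_fst'[OF this]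
    have "(LINT z|(\<mu> \<Otimes>\<^sub>M \<mu>). \<bar>fst z - snd z\<bar>) = (LINT x|\<mu>. \<rho> x)" by (simp add: \<rho>\<mu>)
    also have "\<dots> = expectation (\<lambda>\<omega>. \<rho> (X 1 \<omega>))"
      unfolding \<mu>_def using m\<rho> by (intro integral_distr X1) auto
    finally show ?thesis unfolding assms(13) \<mu> \<theta>_def .
  qed
  have "variance (\<lambda>\<omega>. \<rho> (X 1 \<omega>)) = covariance M (\<lambda>\<omega>. \<rho> (X 1 \<omega>)) (\<lambda>\<omega>. \<rho> (X 1 \<omega>))"
    unfolding covariance_def by (simp add: power2_eq_square)
  with assms(15) show ?thesis
    unfolding \<theta> by (intro gini_clt assms(16)) (simp add: \<rho>)
qed

end
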